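(* Let $\mathcal{X}=[0,1]^d$, let $k$ be a squared-exponential kernel $k(x,y)=\exp(-\|x-y\|^2/(2\ell^2))$, and $\mathcal{B}_k=\{f\in\mathcal{H}_k:\|f\|_{\mathcal{H}_k}\le B\}$. Run Algorithm 5 with a fixed point set $X_{T-1}=\{x_1,\dots,x_{T-1}\}\subset\mathcal{X}$ of fill distance $h_X$. Then there exists a constant $c>0$ such that, whenever $h_X$ is sufficiently small, $\widetilde r_T\le B\exp\!\big(c\log(h_X)/(2\sqrt{h_X})\big)$.
   Context: Algorithm 5: given $f_1,\dots,f_{T-1}\in\mathcal{B}_k$, observe $f_i(x_i)$ for $i\le T-1$; form $m_{T-1}(x)=\mathbf{k}_{T-1}(x)^T\mathbf{K}_{T-1}^{-1}\mathbf{y}$ with $\mathbf{y}=[f_i(x_i)]_{i<T}$ and $\sigma_{T-1}^2(x)=k(x,x)-\mathbf{k}_{T-1}(x)^T\mathbf{K}_{T-1}^{-1}\mathbf{k}_{T-1}(x)$, where $\mathbf{k}_{T-1}(x)=[k(x,x_i)]_{i<T}$, $\mathbf{K}_{T-1}=[k(x_i,x_j)]_{i,j<T}$; choose $x_T\in\arg\max_{x\in\mathcal{X}}m_{T-1}(x)+B\sigma_{T-1}(x)$. Simple adversarial regret: $\widetilde r_T=\min_{t\in[T]}\sup\{\max_{x\in\mathcal{X}}f_t(x)-f_t(x_t):\ f_t\in\mathcal{B}_k,\ f_t(x_i)=f_i(x_i)\ \forall i\in[t-1]\}$. Fill distance: $h_X=\sup_{x\in\mathcal{X}}\min_{x_t\in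 X}\|x-x_t\|$. *)

theory Defs
  imports "HOL-Analysis.Analysis" "HOL-Library.Extended_Real"
begin

definition se_kernel :: "real \<Rightarrow> 'a::real_normed_vector \<Rightarrow> 'a \<Rightarrow> real" where
  "se_kernel l x y = exp (- (norm (x - y))\<^sup>2 / (2 * l\<^sup>2))"

definition unit_cube :: "(real ^ 'd) set" where
  "unit_cube = {x. \<forall>i. 0 \<le> x $ i \<and> x $ i \<le> 1}"

section \<open>RKHS of a kernel k on a domain S (Moore-Aronszajn construction)\<close>

definition h0_rep :: "('a \<Rightarrow> 'a \<Rightarrow> real) \<Rightarrow> 'a set \<Rightarrow> ('a \<Rightarrow> real)
    \<Rightarrow> nat \<Rightarrow> (nat \<Rightarrow> real) \<Rightarrow> (nat \<Rightarrow> 'a) \<Rightarrow> bool" where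
  "h0_rep k S g n a z \<longleftrightarrow>
     (\<forall>i<n. z i \<in> S) \<and> (\<forall>x\<in>S. g x = (\<Sum>i<n. a i * k x (z i)))"

definition in_H0 :: "('a \<Rightarrow> 'a \<Rightarrow> real) \<Rightarrow> 'a set \<Rightarrow> ('a \<Rightarrow> real) \<Rightarrow> bool" where
  "in_H0 k S g \<longleftrightarrow> (\<exists>n a z. h0_rep k S g n a z)"

text \<open>Norm on H0 (independent of the representation for a positive definite kernel).\<close>
definition h0_norm :: "('a \<Rightarrow> 'a \<Rightarrow> real) \<Rightarrow> 'a set \<Rightarrow> ('a \<Rightarrow> real) \<Rightarrow> real" where
  "h0_norm k S g = Inf {sqrt (\<Sum>i<n. \<Sum>j<n. a i * a j * k (z i) (z j)) | n a z. h0_rep k S g n a z}"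

definition rkhs_approx :: "('a \<Rightarrow> 'a \<Rightarrow> real) \<Rightarrow> 'a set \<Rightarrow> ('a \<Rightarrow> real)
    \<Rightarrow> (nat \<Rightarrow> 'a \<Rightarrow> real) \<Rightarrow> bool" where
  "rkhs_approx k S f g \<longleftrightarrow>
     (\<forall>n. in_H0 k S (g n)) \<and>
     (\<forall>e>0. \<exists>N. \<forall>m\<ge>N. \<forall>n\<ge>N. h0_norm k S (\<lambda>x. g m x - g n x) < e) \<and>
     (\<forall>x\<in>S. (\<lambda>n. g n x) \<longlonglongrightarrow> f x)"

definition in_rkhs :: "('a \<Rightarrow> 'a \<Rightarrow> real) \<Rightarrow> 'a set \<Rightarrow> ('a \<Rightarrow> real) \<Rightarrow> bool" where
  "in_rkhs k S f \<longleftrightarrow> (\<exists>g. rkhs_approx k S f g)"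

definition rkhs_norm :: "('a \<Rightarrow> 'a \<Rightarrow> real) \<Rightarrow> 'a set \<Rightarrow> ('a \<Rightarrow> real) \<Rightarrow> real" where
  "rkhs_norm k S f = Inf {L. \<exists>g. rkhs_approx k S f g \<and> (\<lambda>n. h0_norm k S (g n)) \<longlonglongrightarrow> L}"

definition rkhs_ball :: "('a \<Rightarrow> 'a \<Rightarrow> real) \<Rightarrow> 'a set \<Rightarrow> real \<Rightarrow> ('a \<Rightarrow> real) set" where
  "rkhs_ball k S B = {f. in_rkhs k S f \<and> rkhs_norm k S f \<le> B}"

definition mat_inv_n :: "nat \<Rightarrow> (nat \<Rightarrow> nat \<Rightarrow> real) \<Rightarrow> (nat \<Rightarrow> nat \<Rightarrow> real)" where
  "mat_inv_n n K = (THE M.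
     (\<forall>i\<in>{1..n}. \<forall>j\<in>{1..n}. (\<Sum>l\<in>{1..n}. K i l * M l j) = (if i = j then 1 else 0)) \<and>
     (\<forall>i\<in>{1..n}. \<forall>j\<in>{1..n}. (\<Sum>l\<in>{1..n}. M i l * K l j) = (if i = j then 1 else 0)) \<and>
     (\<forall>i j. \<not> (i \<in> {1..n} \<and> j \<in> {1..n}) \<longrightarrow> M i j = 0))"

definition gram :: "('a \<Rightarrow> 'a \<Rightarrow> real) \<Rightarrow> (nat \<Rightarrow> 'a) \<Rightarrow> nat \<Rightarrow> nat \<Rightarrow> real" where
  "gram k xs i j = k (xs i) (xs j)"

definition post_mean :: "('a \<Rightarrow> 'a \<Rightarrow> real) \<Rightarrow> (nat \<Rightarrow> 'a) \<Rightarrow> (nat \<Rightarrow> 'a \<Rightarrow> real)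
    \<Rightarrow> nat \<Rightarrow> 'a \<Rightarrow> real" where
  "post_mean k xs f n x =
     (\<Sum>i\<in>{1..n}. \<Sum>j\<in>{1..n}. k x (xs i) * mat_inv_n n (gram k xs) i j * f j (xs j))"

definition post_var :: "('a \<Rightarrow> 'a \<Rightarrow> real) \<Rightarrow> (nat \<Rightarrow> 'a) \<Rightarrow> nat \<Rightarrow> 'a \<Rightarrow> real" where
  "post_var k xs n x = k x x -
     (\<Sum>i\<in>{1..n}. \<Sum>j\<in>{1..n}. k x (xs i) * mat_inv_n n (gram k xs) i j * k x (xs j))"

definition post_sd :: "('a \<Rightarrow> 'a \<Rightarrow> real) \<Rightarrow> (nat \<Rightarrow> 'a) \<Rightarrow> nat \<Rightarrow> 'a \<Rightarrow> real" where
  "post_sd k xs n x = sqrt (post_var k xs n x)"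

definition ucb_choice :: "('a \<Rightarrow> 'a \<Rightarrow> real) \<Rightarrow> 'a set \<Rightarrow> real \<Rightarrow> (nat \<Rightarrow> 'a)
    \<Rightarrow> (nat \<Rightarrow> 'a \<Rightarrow> real) \<Rightarrow> nat \<Rightarrow> bool" where
  "ucb_choice k S B xs f T \<longleftrightarrow> xs T \<in> S \<and>
     (\<forall>x\<in>S. post_mean k xs f (T - 1) x + B * post_sd k xs (T - 1) x
            \<le> post_mean k xs f (T - 1) (xs T) + B * post_sd k xs (T - 1) (xs T))"

text \<open>Per-round value: sup over consistent f_t \<in> B_k (sup of the empty set is -\<infinity>).\<close>
definition adv_regret_round :: "('a \<Rightarrow> 'a \<Rightarrow> real) \<Rightarrow> 'a set \<Rightarrow> real \<Rightarrow> (nat \<Rightarrow> 'a)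
    \<Rightarrow> (nat \<Rightarrow> 'a \<Rightarrow> real) \<Rightarrow> nat \<Rightarrow> ereal" where
  "adv_regret_round k S B xs f t =
     (SUP g \<in> {g \<in> rkhs_ball k S B. \<forall>i\<in>{1..<t}. g (xs i) = f i (xs i)}.
        ereal (Sup (g ` S) - g (xs t)))"

definition simple_adv_regret :: "('a \<Rightarrow> 'a \<Rightarrow> real) \<Rightarrow> 'a set \<Rightarrow> real \<Rightarrow> (nat \<Rightarrow> 'a)
    \<Rightarrow> (nat \<Rightarrow> 'a \<Rightarrow> real) \<Rightarrow> nat \<Rightarrow> ereal" where
  "simple_adv_regret k S B xs f T = Min ((\<lambda>t. adv_regret_round k S B xs f t) ` {1..T})"

definition fill_distance :: "'a::metric_space set \<Rightarrow> 'a set \<Rightarrow> real" where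
  "fill_distance S P = (SUP x\<in>S. INF p\<in>P. dist x p)"

end

theory Submission
  imports Defs "HOL-Complex_Analysis.Conformal_Mappings" "HOL-Real_Asymp.Real_Asymp"
begin

text \<open>
  A function in the ball that agrees with the data differs from the posterior mean at \<open>x\<close> by at
  most \<open>B \<sigma>(x)\<close>, so the UCB choice has regret at most \<open>2 B \<sigma>(x\<^sub>T)\<close>, and it remains to bound \<open>\<sigma>\<close>.
  Let \<open>g\<close> be \<open>k(x, \<cdot>)\<close> minus its interpolant; \<open>g\<close> vanishes on the data points and \<open>g(x) = \<sigma>(x)\<^sup>2\<close> is
  its squared norm. Expanding \<open>exp (s \<bullet> z / l\<^sup>2)\<close> in a power series writes
  \<open>exp (\<bar>s\<bar>\<^sup>2 / (2 l\<^sup>2)) g(s)\<close> as a polynomial of degree less than \<open>N\<close> plus a tail. The tail of the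
  series is itself a positive semidefinite kernel dominated by \<open>k\<close>, so Cauchy-Schwarz bounds the
  tail by \<open>\<surd>\<tau> \<sigma>(x)\<close> with \<open>\<tau> = e\<^sup>A A\<^sup>N / N!\<close> and \<open>A = d / l\<^sup>2\<close>. By a Markov inequality in each
  coordinate, a point set of fill distance of order \<open>N\<^sup>-\<^sup>2\<close> is norming for polynomials of degree
  \<open>N\<close>; on the data points the polynomial is minus the tail, hence it is at most \<open>2 \<surd>\<tau> \<sigma>(x)\<close>
  everywhere. Thus \<open>\<sigma>(x)\<^sup>2 \<le> 3 \<surd>\<tau> \<sigma>(x)\<close>, and \<open>N\<close> of order \<open>h\<^sup>-\<^sup>1\<^sup>/\<^sup>2\<close> gives the rate.
\<close>

section \<open>Positive semidefinite kernels\<close>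

text \<open>Finitely supported signed measures are lists of weighted points, possibly with repetitions.\<close>

definition signed_sum :: "(real \<times> 'a) list \<Rightarrow> ('a \<Rightarrow> real) \<Rightarrow> real" where
  "signed_sum L f = (\<Sum>(w, z)\<leftarrow>L. w * f z)"

lemma signed_sum_Nil [simp]: "signed_sum [] f = 0"
  by (simp add: signed_sum_def)

lemma signed_sum_Cons [simp]: "signed_sum ((w, z) # L) f = w * f z + signed_sum L f"
  by (simp add: signed_sum_def)

lemma signed_sum_append: "signed_sum (L @ M) f = signed_sum L f + signed_sum M f"
  by (simp add: signed_sum_def)

lemma signed_sum_reweight:
  "signed_sum (map (\<lambda>(w, z). (w * g z, z)) L) f = signed_sum L (\<lambda>z. g z * f z)"
  by (induction L) (auto simp: algebra_simps)

lemma signed_sum_add: "signed_sum L (\<lambda>z. f z + g z) = signed_sum L f + signed_sum L g"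
  by (induction L) (auto simp: algebra_simps)

lemma signed_sum_cmult: "signed_sum L (\<lambda>z. c * f z) = c * signed_sum L f"
  by (induction L) (auto simp: algebra_simps)

lemma signed_sum_zero: "signed_sum L (\<lambda>z. 0) = 0"
  by (induction L) auto

lemma signed_sum_sum: "signed_sum L (\<lambda>z. \<Sum>i\<in>I. f i z) = (\<Sum>i\<in>I. signed_sum L (f i))"
  by (induction L) (auto simp: sum.distrib sum_distrib_left)

lemma signed_sum_cong:
  "(\<And>z. z \<in> snd ` set L \<Longrightarrow> f z = g z) \<Longrightarrow> signed_sum L f = signed_sum L g"
  by (induction L) auto

lemma signed_sum_swap:
  "signed_sum L (\<lambda>x. signed_sum M (\<lambda>y. K x y)) = signed_sum M (\<lambda>y. signed_sum L (\<lambda>x. K x y))"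
  by (induction L) (auto simp: signed_sum_add signed_sum_cmult signed_sum_zero)

lemma signed_sum_sums:
  assumes "\<And>z. (\<lambda>n. F n z) sums G z"
  shows "(\<lambda>n. signed_sum L (F n)) sums signed_sum L G"
proof (induction L)
  case (Cons p L)
  then show ?case
    by (cases p) (auto intro!: sums_add sums_mult assms)
qed simp

lemma signed_sum_tendsto:
  assumes "\<And>z. z \<in> snd ` set L \<Longrightarrow> (\<lambda>n. F n z) \<longlonglongrightarrow> G z"
  shows "(\<lambda>n. signed_sum L (F n)) \<longlonglongrightarrow> signed_sum L G"
  using assms
proof (induction L)
  case (Cons p L)
  then show ?case
    by (cases p) (auto intro!: tendsto_intros)
qed simp

lemma signed_sum_map_upt:
  "signed_sum (map (\<lambda>i. (a i, z i)) [m..<n]) f = (\<Sum>i=m..<n. a i * f (z i))"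
  by (simp add: signed_sum_def comp_def interv_sum_list_conv_sum_set_nat)

text \<open>For positive semidefinite \<open>K\<close> this is the RKHS inner product of the
  embedded measures, so \<open>energy\<close> is the squared norm of the functional
  \<open>f \<mapsto> signed_sum L f\<close>.\<close>

definition pairing :: "('a \<Rightarrow> 'a \<Rightarrow> real) \<Rightarrow> (real \<times> 'a) list \<Rightarrow> (real \<times> 'a) list \<Rightarrow> real" where
  "pairing K L M = signed_sum L (\<lambda>x. signed_sum M (K x))"

abbreviation energy :: "('a \<Rightarrow> 'a \<Rightarrow> real) \<Rightarrow> (real \<times> 'a) list \<Rightarrow> real" where
  "energy K L \<equiv> pairing K L L"

definition psd_kernel :: "('a \<Rightarrow> 'a \<Rightarrow> real) \<Rightarrow> bool" where
  "psd_kernel K \<longleftrightarrow> (\<forall>x y. K x y = K y x) \<and> (\<forall>L. energy K L \<ge> 0)"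

lemma psd_kernel_energy: "psd_kernel K \<Longrightarrow> energy K L \<ge> 0"
  by (simp add: psd_kernel_def)

lemma pairing_commute:
  assumes "psd_kernel K" shows "pairing K L M = pairing K M L"
proof -
  have "(\<lambda>x. K x y) = K y" for y
    using assms by (auto simp: psd_kernel_def)
  then show ?thesis
    unfolding pairing_def by (subst signed_sum_swap) simp
qed

definition scale :: "real \<Rightarrow> (real \<times> 'a) list \<Rightarrow> (real \<times> 'a) list" where
  "scale c L = map (\<lambda>(w, z). (w * c, z)) L"

lemma signed_sum_scale: "signed_sum (scale c L) f = c * signed_sum L f"
  by (simp add: scale_def signed_sum_reweight[where g = "\<lambda>_. c"] signed_sum_cmult)

lemma snd_set_scale [simp]: "snd ` set (scale c L) = snd ` set L"
  by (force simp: scale_def)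

lemma energy_add_scale:
  assumes "psd_kernel K"
  shows "energy K (L @ scale c M) = energy K L + 2 * c * pairing K L M + c\<^sup>2 * energy K M"
proof -
  have "energy K (L @ scale c M) = energy K L + c * pairing K L M + c * pairing K M L + c * (c * energy K M)"
    by (simp add: pairing_def signed_sum_append signed_sum_scale signed_sum_add signed_sum_cmult)
       (simp add: algebra_simps)
  then show ?thesis
    by (simp add: pairing_commute[OF assms, of M L] power2_eq_square)
qed

text \<open>The quadratic \<open>t \<mapsto> energy K (L @ scale t M)\<close> is never negative, so
  its discriminant is not positive.\<close>

lemma pairing_Cauchy_Schwarz:
  assumes "psd_kernel K"
  shows "\<bar>pairing K L M\<bar> \<le> sqrt (energy K L) * sqrt (energy K M)"
proof -
  let ?a = "energy K L" and ?b = "pairing K L M" and ?c = "energy K M"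
  have q: "?a + 2 * t * ?b + t\<^sup>2 * ?c \<ge> 0" for t
    using psd_kernel_energy[OF assms, of "L @ scale t M"] energy_add_scale[OF assms] by metis
  have a: "?a \<ge> 0" and c: "?c \<ge> 0"
    using assms by (auto intro: psd_kernel_energy)
  have "?b\<^sup>2 \<le> ?a * ?c"
  proof (cases "?c = 0")
    case True
    have "?b = 0"
    proof (rule ccontr)
      assume "?b \<noteq> 0"
      \<comment> \<open>At this \<open>t\<close> the expression, linear since \<open>?c = 0\<close>,
        equals -1.\<close>
      then show False
        using q[of "- (?a + 1) / (2 * ?b)"] True by (simp add: field_simps)
    qed
    then show ?thesis using True by simp
  next
    case False
    with c have "?c > 0" by simp
    \<comment> \<open>\<open>- ?b / ?c\<close> minimises the quadratic.\<close>
    then show ?thesis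
      using q[of "- ?b / ?c"] by (simp add: field_simps power2_eq_square)
  qed
  then have "\<bar>?b\<bar> \<le> sqrt (?a * ?c)"
    by (simp add: real_le_rsqrt)
  then show ?thesis by (simp add: real_sqrt_mult)
qed

text \<open>Cauchy-Schwarz against the unit point mass at \<open>s\<close>, whose energy is
  \<open>K s s\<close>.\<close>

lemma signed_sum_kernel_le:
  assumes "psd_kernel K"
  shows "\<bar>signed_sum L (K s)\<bar> \<le> sqrt (K s s) * sqrt (energy K L)"
  using pairing_Cauchy_Schwarz[OF assms, of "[(1, s)]" L] by (simp add: pairing_def)

lemma sqrt_energy_triangle:
  assumes "psd_kernel K"
  shows "sqrt (energy K (L @ scale c M)) \<le> sqrt (energy K L) + \<bar>c\<bar> * sqrt (energy K M)"
proof (rule real_le_lsqrt)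
  have "c * pairing K L M \<le> \<bar>c\<bar> * \<bar>pairing K L M\<bar>"
    by (metis abs_ge_self abs_mult)
  also have "\<dots> \<le> \<bar>c\<bar> * (sqrt (energy K L) * sqrt (energy K M))"
    by (intro mult_left_mono pairing_Cauchy_Schwarz assms) auto
  finally show "energy K (L @ scale c M) \<le> (sqrt (energy K L) + \<bar>c\<bar> * sqrt (energy K M))\<^sup>2"
    unfolding energy_add_scale[OF assms]
    by (simp add: power2_sum power_mult_distrib psd_kernel_energy[OF assms] algebra_simps)
qed (auto intro!: add_nonneg_nonneg mult_nonneg_nonneg psd_kernel_energy assms)

section \<open>Closure properties of positive semidefinite kernels\<close>

lemma psd_kernel_const: "psd_kernel (\<lambda>x y. 1)"
proof -
  have "energy (\<lambda>x y. 1) L = (signed_sum L (\<lambda>_. 1))\<^sup>2" for L :: "(real \<times> 'a) list"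
    using signed_sum_cmult[of L "signed_sum L (\<lambda>_. 1)" "\<lambda>_. 1"]
    by (simp add: pairing_def power2_eq_square)
  then show ?thesis by (simp add: psd_kernel_def)
qed

lemma psd_kernel_conjugate:
  assumes "psd_kernel K"
  shows "psd_kernel (\<lambda>x y. g x * g y * K x y)"
proof -
  have "energy (\<lambda>x y. g x * g y * K x y) L = energy K (map (\<lambda>(w, z). (w * g z, z)) L)" for L
    by (simp add: pairing_def signed_sum_reweight mult.assoc signed_sum_cmult)
  with assms show ?thesis
    by (auto simp: psd_kernel_def)
qed

lemma psd_kernel_scale:
  assumes "psd_kernel K" "c \<ge> 0"
  shows "psd_kernel (\<lambda>x y. c * K x y)"
proof -
  have "energy (\<lambda>x y. c * K x y) L = c * energy K L" for L
    by (simp add: pairing_def signed_sum_cmult)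
  with assms show ?thesis
    by (auto simp: psd_kernel_def)
qed

lemma psd_kernel_sum:
  assumes "\<And>i. i \<in> I \<Longrightarrow> psd_kernel (K i)"
  shows "psd_kernel (\<lambda>x y. \<Sum>i\<in>I. K i x y)"
proof -
  have "energy (\<lambda>x y. \<Sum>i\<in>I. K i x y) L = (\<Sum>i\<in>I. energy (K i) L)" for L
    by (simp add: pairing_def signed_sum_sum)
  with assms show ?thesis
    by (auto simp: psd_kernel_def intro!: sum_nonneg sum.cong)
qed

lemma psd_kernel_sums:
  assumes "\<And>n. psd_kernel (K n)" and "\<And>x y. (\<lambda>n. K n x y) sums G x y"
  shows "psd_kernel G"
proof -
  have "energy G L \<ge> 0" for L
  proof (rule sums_le[OF _ sums_zero])
    show "(\<lambda>n. energy (K n) L) sums energy G L"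
      unfolding pairing_def by (intro signed_sum_sums assms)
  qed (use assms(1) in \<open>auto intro: psd_kernel_energy\<close>)
  moreover have "G x y = G y x" for x y
  proof -
    have "(\<lambda>n. K n x y) = (\<lambda>n. K n y x)"
      using assms(1) by (auto simp: psd_kernel_def)
    then show ?thesis
      using sums_unique2[OF assms(2)[of x y]] assms(2)[of y x] by simp
  qed
  ultimately show ?thesis by (simp add: psd_kernel_def)
qed

text \<open>Expanding the inner product over \<open>Basis\<close> gives a sum of conjugates of
  \<open>K\<close> by the coordinate functions.\<close>

lemma psd_kernel_inner_mult:
  fixes K :: "'a::euclidean_space \<Rightarrow> 'a \<Rightarrow> real"
  assumes "psd_kernel K"
  shows "psd_kernel (\<lambda>x y. (x \<bullet> y) * K x y)"
proof -
  have "psd_kernel (\<lambda>x y. \<Sum>b\<in>Basis. (x \<bullet> b) * (y \<bullet> b) * K x y)"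
    by (intro psd_kernel_sum psd_kernel_conjugate assms)
  moreover have "(\<lambda>x y. \<Sum>b\<in>Basis. (x \<bullet> b) * (y \<bullet> b) * K x y) = (\<lambda>x y. (x \<bullet> y) * K x y)"
    by (intro ext, subst (2) euclidean_inner) (simp add: sum_distrib_right)
  ultimately show ?thesis by simp
qed

lemma psd_kernel_inner_power: "psd_kernel (\<lambda>x y :: 'a::euclidean_space. (x \<bullet> y) ^ n)"
  by (induction n) (use psd_kernel_const psd_kernel_inner_mult in auto)

section \<open>The squared-exponential kernel and its power series\<close>

definition gauss :: "real \<Rightarrow> 'a::real_inner \<Rightarrow> real" where
  "gauss l x = exp (- (norm x)\<^sup>2 / (2 * l\<^sup>2))"

lemma gauss_pos: "gauss l x > 0"
  by (simp add: gauss_def)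

lemma se_kernel_eq: 
  fixes x y :: "'a::real_inner"
  assumes "l \<noteq> 0"
  shows "se_kernel l x y = gauss l x * gauss l y * exp ((x \<bullet> y) / l\<^sup>2)"
  using assms
  by (simp add: se_kernel_def gauss_def power2_norm_eq_inner exp_add[symmetric] inner_diff inner_commute
        divide_simps)

definition exp_tail :: "nat \<Rightarrow> real \<Rightarrow> real" where
  "exp_tail N a = exp a - (\<Sum>n<N. a ^ n / fact n)"

lemma exp_tail_sums: "(\<lambda>n. if n < N then 0 else a ^ n / fact n) sums exp_tail N a"
proof -
  have "(\<lambda>n. a ^ n / fact n) sums exp a"
    using exp_converges[of a] by (simp add: divide_inverse mult.commute)
  moreover have "(\<lambda>n. if n < N then a ^ n / fact n else 0) sums (\<Sum>n<N. a ^ n / fact n)"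
    using sums_If_finite_set[of "{..<N}" "\<lambda>n. a ^ n / fact n"] by simp
  ultimately have "(\<lambda>n. a ^ n / fact n - (if n < N then a ^ n / fact n else 0)) sums exp_tail N a"
    unfolding exp_tail_def by (rule sums_diff)
  then show ?thesis
    by (rule sums_cong[THEN iffD1, rotated]) auto
qed

text \<open>Lagrange form of the remainder; the intermediate point \<open>t\<close> satisfies
  \<open>t \<le> a \<le> A\<close>.\<close>

lemma exp_tail_le:
  assumes "0 \<le> a" "a \<le> A" shows "exp_tail N a \<le> exp A * A ^ N / fact N"
proof -
  obtain t where t: "\<bar>t\<bar> \<le> \<bar>a\<bar>" "exp a = (\<Sum>n<N. a ^ n / fact n) + exp t / fact N * a ^ N"
    using Maclaurin_exp_le[of a N] by blast
  have "exp_tail N a = exp t * a ^ N / fact N"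
    using t by (simp add: exp_tail_def)
  also have "\<dots> \<le> exp A * A ^ N / fact N"
    using t assms by (intro divide_right_mono mult_mono power_mono) auto
  finally show ?thesis .
qed

text \<open>The coefficients of the series in \<open>(x \<bullet> y) ^ n\<close> are nonnegative:
  zero below \<open>N\<close>, then \<open>1 / (fact n * l ^ (2 * n))\<close>.\<close>

lemma psd_kernel_exp_tail:
  "psd_kernel (\<lambda>x y :: 'a::euclidean_space. gauss l x * gauss l y * exp_tail N ((x \<bullet> y) / l\<^sup>2))"
proof (rule psd_kernel_conjugate, rule psd_kernel_sums)
  fix n
  show "psd_kernel (\<lambda>x y :: 'a. (if n < N then 0 else 1 / (fact n * l ^ (2 * n))) * (x \<bullet> y) ^ n)"
    by (intro psd_kernel_scale psd_kernel_inner_power) (auto simp: power_mult)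
next
  fix x y :: 'a
  show "(\<lambda>n. (if n < N then 0 else 1 / (fact n * l ^ (2 * n))) * (x \<bullet> y) ^ n)
          sums exp_tail N ((x \<bullet> y) / l\<^sup>2)"
    by (rule sums_cong[THEN iffD1, OF _ exp_tail_sums]) (auto simp: power_divide power_mult)
qed

lemma psd_kernel_exp_head:
  "psd_kernel (\<lambda>x y :: 'a::euclidean_space.
     gauss l x * gauss l y * (\<Sum>n<N. ((x \<bullet> y) / l\<^sup>2) ^ n / fact n))"
proof (rule psd_kernel_conjugate, rule psd_kernel_sum)
  fix n
  have "psd_kernel (\<lambda>x y :: 'a. 1 / (fact n * l ^ (2 * n)) * (x \<bullet> y) ^ n)"
    by (intro psd_kernel_scale psd_kernel_inner_power) (auto simp: power_mult)
  then show "psd_kernel (\<lambda>x y :: 'a. ((x \<bullet> y) / l\<^sup>2) ^ n / fact n)"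
    by (simp add: power_divide power_mult[symmetric] mult.commute)
qed

lemma psd_se_kernel:
  assumes "l \<noteq> 0" shows "psd_kernel (se_kernel l :: 'a::euclidean_space \<Rightarrow> 'a \<Rightarrow> real)"
  \<comment> \<open>At \<open>N = 0\<close> the tail is the whole exponential.\<close>
  using psd_kernel_exp_tail[of l 0, where 'a = 'a] assms
  by (simp add: exp_tail_def se_kernel_eq[OF assms, abs_def])

text \<open>The kernel is the sum of its tail and its head, and the head has nonnegative
  energy.\<close>

lemma energy_exp_tail_le:
  fixes L :: "(real \<times> 'a::euclidean_space) list"
  assumes "l \<noteq> 0"
  shows "energy (\<lambda>x y. gauss l x * gauss l y * exp_tail N ((x \<bullet> y) / l\<^sup>2)) L \<le> energy (se_kernel l) L"
proof -
  let ?T = "\<lambda>x y :: 'a. gauss l x * gauss l y * exp_tail N ((x \<bullet> y) / l\<^sup>2)"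
  let ?P = "\<lambda>x y :: 'a. gauss l x * gauss l y * (\<Sum>n<N. ((x \<bullet> y) / l\<^sup>2) ^ n / fact n)"
  have "se_kernel l = (\<lambda>x y. ?T x y + ?P x y)"
    by (intro ext) (simp add: se_kernel_eq[OF assms] exp_tail_def algebra_simps)
  then have "energy (se_kernel l) L = energy ?T L + energy ?P L"
    by (simp add: pairing_def signed_sum_add)
  then show ?thesis
    using psd_kernel_energy[OF psd_kernel_exp_head[of l N], of L] by simp
qed

section \<open>A Markov inequality\<close>

text \<open>
  The map \<open>w \<mapsto> w\<^sup>n q((w + 1/w)/2)\<close> is a polynomial, and on the unit circle the argument of \<open>q\<close> is
  \<open>Re w\<close>; so the maximum principle controls \<open>q\<close> on ellipses with foci \<open>-1\<close> and \<open>1\<close>.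
\<close>

lemma poly_Joukowski_bound:
  fixes c :: "nat \<Rightarrow> complex"
  assumes M: "\<And>u::real. \<bar>u\<bar> \<le> 1 \<Longrightarrow> norm (\<Sum>k\<le>n. c k * of_real u ^ k) \<le> M"
    and w: "w \<noteq> 0" "norm w \<le> 1"
  shows "norm (\<Sum>k\<le>n. c k * ((w + 1 / w) / 2) ^ k) * norm w ^ n \<le> M"
proof -
  define P where "P w = (\<Sum>k\<le>n. c k * (w ^ (n - k) * ((w\<^sup>2 + 1) / 2) ^ k))" for w :: complex
  have P_eq: "P v = v ^ n * (\<Sum>k\<le>n. c k * ((v + 1 / v) / 2) ^ k)" if "v \<noteq> 0" for v
  proof -
    have "v ^ (n - k) * ((v\<^sup>2 + 1) / 2) ^ k = v ^ n * ((v + 1 / v) / 2) ^ k" if "k \<le> n" for k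
    proof -
      have "(v\<^sup>2 + 1) / 2 = v * ((v + 1 / v) / 2)"
        using \<open>v \<noteq> 0\<close> by (simp add: field_simps power2_eq_square)
      then have "v ^ (n - k) * ((v\<^sup>2 + 1) / 2) ^ k = (v ^ (n - k) * v ^ k) * ((v + 1 / v) / 2) ^ k"
        by (simp only: power_mult_distrib mult.assoc)
      also have "v ^ (n - k) * v ^ k = v ^ n"
        using that by (simp flip: power_add)
      finally show ?thesis .
    qed
    then show ?thesis
      unfolding P_def sum_distrib_left by (intro sum.cong) (auto simp: mult.left_commute)
  qed
  have "norm (P w) \<le> M"
  proof (rule maximum_modulus_frontier[of P "cball 0 1"])
    show "P holomorphic_on interior (cball 0 1)"
      unfolding P_def by (intro holomorphic_intros) simp
    show "continuous_on (closure (cball 0 1)) P"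
      unfolding P_def by (intro continuous_intros) simp
    fix v :: complex assume "v \<in> frontier (cball 0 1)"
    then have v: "norm v = 1" by auto
    then have "v \<noteq> 0" by auto
    have "1 / v = cnj v"
      using complex_norm_square[of v] v \<open>v \<noteq> 0\<close> by (simp add: divide_eq_eq mult.commute)
    then have "(v + 1 / v) / 2 = of_real (Re v)"
      using complex_add_cnj[of v] by simp
    then show "norm (P v) \<le> M"
      using M[of "Re v"] P_eq[OF \<open>v \<noteq> 0\<close>] v abs_Re_le_cmod[of v]
      by (simp add: norm_mult norm_power)
  qed (use w in auto)
  then show ?thesis
    using P_eq[OF w(1)] by (simp add: norm_mult norm_power mult.commute)
qed

text \<open>The two roots of \<open>w\<^sup>2 - 2 * z * w + 1\<close> have product 1, so one of them
  lies in the closed unit disc.\<close>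

lemma Joukowski_preimage:
  fixes z :: complex
  obtains w where "w \<noteq> 0" "norm w \<le> 1" "z = (w + 1 / w) / 2"
proof -
  define w where "w = z + csqrt (z\<^sup>2 - 1)"
  define w' where "w' = z - csqrt (z\<^sup>2 - 1)"
  have prod: "w * w' = 1"
    using power2_csqrt[of "z\<^sup>2 - 1"]
    by (simp add: w_def w'_def algebra_simps power2_eq_square)
  then have nz: "w \<noteq> 0" "w' \<noteq> 0" by auto
  have inv: "w' = 1 / w" "w = 1 / w'"
    using prod nz by (simp_all add: eq_divide_eq mult.commute)
  have z: "z = (w + w') / 2"
    by (simp add: w_def w'_def)
  have "norm w \<le> 1 \<or> norm w' \<le> 1"
  proof (rule ccontr)
    assume "\<not> ?thesis"
    then have "1 * 1 < norm w * norm w'"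
      by (intro mult_strict_mono) auto
    then show False using prod by (simp flip: norm_mult)
  qed
  then show thesis
  proof
    assume "norm w \<le> 1"
    moreover have "z = (w + 1 / w) / 2" using z inv(1) by simp
    ultimately show thesis using that nz by blast
  next
    assume "norm w' \<le> 1"
    moreover have "z = (w' + 1 / w') / 2" using z inv(2) by (simp add: add.commute)
    ultimately show thesis using that nz by blast
  qed
qed

text \<open>Both focal differences are squares divided by \<open>2 * w\<close>; the parallelogram
  law for \<open>w - 1\<close> and \<open>w + 1\<close> does the rest. Circles thus go to ellipses
  with foci -1 and 1.\<close>

lemma Joukowski_foci:
  fixes w :: complex
  assumes "w \<noteq> 0"
  shows "norm ((w + 1 / w) / 2 - 1) + norm ((w + 1 / w) / 2 + 1) = norm w + 1 / norm w"
proof -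
  have "(w + 1 / w) / 2 - 1 = (w - 1)\<^sup>2 / (2 * w)" "(w + 1 / w) / 2 + 1 = (w + 1)\<^sup>2 / (2 * w)"
    using assms by (auto simp: field_simps power2_eq_square)
  moreover have "(norm (w - 1))\<^sup>2 + (norm (w + 1))\<^sup>2 = 2 * (norm w)\<^sup>2 + 2"
    unfolding cmod_power2 by (simp add: power2_eq_square algebra_simps)
  ultimately have "norm ((w + 1 / w) / 2 - 1) + norm ((w + 1 / w) / 2 + 1) = (2 * (norm w)\<^sup>2 + 2) / (2 * norm w)"
    by (simp add: norm_divide norm_mult norm_power flip: add_divide_distrib)
  also have "\<dots> = norm w + 1 / norm w"
    using assms by (simp add: field_simps power2_eq_square)
  finally show ?thesis .
qed

text \<open>So close to the interval, the sum of the distances to the foci forces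
  \<open>norm w \<ge> 1 - 1 / (2 * n)\<close>. Hence \<open>norm w ^ n \<ge> 1 / 2\<close>, and the
  Joukowski bound loses only a factor 2.\<close>

lemma poly_bound_near_interval:
  fixes c :: "nat \<Rightarrow> complex"
  assumes M: "\<And>u::real. \<bar>u\<bar> \<le> 1 \<Longrightarrow> norm (\<Sum>k\<le>n. c k * of_real u ^ k) \<le> M"
    and x: "\<bar>x\<bar> \<le> 1" and n: "n > 0"
    and z: "norm (z - of_real x) \<le> 1 / (8 * real n ^ 2)"
  shows "norm (\<Sum>k\<le>n. c k * z ^ k) \<le> 2 * M"
proof -
  obtain w where w: "w \<noteq> 0" "norm w \<le> 1" "z = (w + 1 / w) / 2"
    by (rule Joukowski_preimage)
  let ?t = "norm w" and ?r = "1 / (8 * real n ^ 2)"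
  have t: "?t > 0" using w by simp
  have "norm (z - 1) \<le> norm (z - of_real x) + (1 - x)"
    using norm_triangle_ineq[of "z - of_real x" "of_real (x - 1)"] x
    by (simp del: of_real_diff add: norm_of_real) (simp add: abs_if split: if_splits)
  moreover have "norm (z + 1) \<le> norm (z - of_real x) + (1 + x)"
    using norm_triangle_ineq[of "z - of_real x" "of_real (x + 1)"] x
    by (simp del: of_real_add add: norm_of_real) (simp add: abs_if split: if_splits)
  ultimately have "?t + 1 / ?t \<le> 2 + 2 * ?r"
    using Joukowski_foci[OF w(1), folded w(3)] z by linarith
  \<comment> \<open>\<open>t + 1 / t - 2\<close> is \<open>(1 - t)\<^sup>2 / t\<close>. The radius
    is chosen to make \<open>2 * ?r\<close> the square of \<open>1 / (2 * n)\<close>.\<close>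
  then have "(1 - ?t)\<^sup>2 \<le> 2 * ?r * ?t"
    using t by (simp add: field_simps power2_eq_square)
  also have "\<dots> \<le> 2 * ?r"
    using w(2) by (intro mult_left_le) auto
  also have "\<dots> = (1 / (2 * real n))\<^sup>2"
    by (simp add: power_divide)
  finally have "1 - ?t \<le> 1 / (2 * real n)"
    by (rule power2_le_imp_le) simp
  then have "real n * (1 - ?t) \<le> 1 / 2"
    using n by (simp add: field_simps)
  moreover have "1 + real n * (?t - 1) \<le> (1 + (?t - 1)) ^ n"
    using t by (intro Bernoulli_inequality) simp
  ultimately have half: "1 / 2 \<le> ?t ^ n"
    by (simp add: algebra_simps)
  have "norm (\<Sum>k\<le>n. c k * z ^ k) * (1 / 2) \<le> norm (\<Sum>k\<le>n. c k * z ^ k) * ?t ^ n"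
    using half by (intro mult_left_mono) auto
  also have "\<dots> \<le> M"
    unfolding w(3) by (rule poly_Joukowski_bound[OF M w(1,2)])
  finally show ?thesis by simp
qed

text \<open>
  The disc of radius \<open>1/(8n\<^sup>2)\<close> about a point of the interval lies in an ellipse on which \<open>q\<close> at most
  doubles, so Cauchy's estimate applies.
\<close>

lemma Markov_derivative_bound:
  fixes q :: "real poly"
  assumes deg: "degree q \<le> n" and M: "\<And>u. \<bar>u\<bar> \<le> 1 \<Longrightarrow> \<bar>poly q u\<bar> \<le> M" and x: "\<bar>x\<bar> \<le> 1"
  shows "\<bar>poly (pderiv q) x\<bar> \<le> 16 * real n ^ 2 * M"
proof (cases "n = 0")
  case True
  with deg obtain a where "q = [:a:]"
    by (metis degree_eq_zeroE le_zero_eq)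
  then show ?thesis by (simp add: True)
next
  case False
  define F where "F z = (\<Sum>k\<le>n. complex_of_real (coeff q k) * z ^ k)" for z :: complex
  have poly_q: "poly q u = (\<Sum>k\<le>n. coeff q k * u ^ k)" for u
    unfolding poly_altdef using deg by (intro sum.mono_neutral_left) (auto simp: coeff_eq_0)
  have F_real: "F (of_real u) = of_real (poly q u)" for u
    by (simp add: F_def poly_q)
  have hol: "F holomorphic_on A" for A
    unfolding F_def by (intro holomorphic_intros)
  let ?r = "1 / (8 * real n ^ 2)"
  \<comment> \<open>The bound \<open>2 * M\<close> divided by the radius
    \<open>1 / (8 * n\<^sup>2)\<close> produces the constant 16.\<close>
  have "norm ((deriv ^^ 1) F (of_real x)) \<le> fact 1 * (2 * M) / ?r ^ 1"
  proof (rule Cauchy_inequality)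
    fix z :: complex assume "norm (of_real x - z) = ?r"
    then have z: "norm (z - of_real x) \<le> ?r" by (simp add: norm_minus_commute)
    show "norm (F z) \<le> 2 * M"
      unfolding F_def
    proof (rule poly_bound_near_interval[OF _ x _ z])
      fix u :: real assume "\<bar>u\<bar> \<le> 1"
      then show "norm (\<Sum>k\<le>n. complex_of_real (coeff q k) * complex_of_real u ^ k) \<le> M"
        using M[of u] F_real[of u] by (simp add: F_def)
    qed (use False in simp)
  qed (use False hol in \<open>auto intro: holomorphic_on_imp_continuous_on\<close>)
  moreover have "deriv F (of_real x) = of_real (poly (pderiv q) x)"
  proof -
    let ?D = "\<Sum>k\<le>n. coeff q k * (real k * x ^ (k - 1))"
    have "(F has_field_derivative of_real ?D) (at (of_real x))"
      unfolding F_def by (auto intro!: derivative_eq_intros sum.cong)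
    moreover have "((\<lambda>u. \<Sum>k\<le>n. coeff q k * u ^ k) has_field_derivative ?D) (at x)"
      by (auto intro!: derivative_eq_intros sum.cong)
    then have "?D = poly (pderiv q) x"
      using poly_DERIV[of q x] DERIV_unique by (simp add: poly_q[abs_def])
    ultimately show ?thesis
      by (metis DERIV_imp_deriv)
  qed
  ultimately show ?thesis by (simp add: mult_ac)
qed

text \<open>Mean value theorem. Rescaling from [-1,1] to [0,1] doubles the Markov constant
  16.\<close>

lemma Markov_variation_bound:
  fixes q :: "real poly"
  assumes deg: "degree q \<le> n" and M: "\<And>u. u \<in> {0..1} \<Longrightarrow> \<bar>poly q u\<bar> \<le> M"
    and "a \<in> {0..1}" "b \<in> {0..1}"
  shows "\<bar>poly q a - poly q b\<bar> \<le> 32 * real n ^ 2 * M * \<bar>a - b\<bar>"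
proof -
  have der: "\<bar>poly (pderiv q) u\<bar> \<le> 32 * real n ^ 2 * M" if "u \<in> {0..1}" for u
  proof -
    let ?q = "pcompose q [:1/2, 1/2:]"
    have "\<bar>poly (pderiv ?q) (2 * u - 1)\<bar> \<le> 16 * real n ^ 2 * M"
    proof (rule Markov_derivative_bound)
      show "degree ?q \<le> n"
        using deg by (simp add: degree_pcompose)
      show "\<bar>poly ?q v\<bar> \<le> M" if "\<bar>v\<bar> \<le> 1" for v
        using M[of "1/2 + v/2"] that by (auto simp: poly_pcompose abs_le_iff)
      show "\<bar>2 * u - 1\<bar> \<le> 1"
        using that by (auto simp: abs_le_iff)
    qed
    moreover have "poly (pderiv ?q) (2 * u - 1) = poly (pderiv q) u / 2"
      by (simp add: pderiv_pcompose poly_pcompose pderiv_pCons field_simps)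
    ultimately show ?thesis by simp
  qed
  have less: "\<bar>poly q a - poly q b\<bar> \<le> 32 * real n ^ 2 * M * \<bar>a - b\<bar>"
    if "a < b" "a \<in> {0..1}" "b \<in> {0..1}" for a b
  proof -
    obtain x where x: "a < x" "x < b" "poly q b - poly q a = (b - a) * poly (pderiv q) x"
      using poly_MVT[OF \<open>a < b\<close>] by blast
    have "\<bar>poly q b - poly q a\<bar> = (b - a) * \<bar>poly (pderiv q) x\<bar>"
      using x by (simp add: abs_mult)
    also have "\<dots> \<le> (b - a) * (32 * real n ^ 2 * M)"
      using x that by (intro mult_left_mono der) auto
    finally show ?thesis
      using that by (simp add: mult.commute abs_minus_commute)
  qed
  show ?thesis
    using less[of a b] less[of b a] assms(3,4)
    by (cases a b rule: linorder_cases) (auto simp: abs_minus_commute)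
qed

section \<open>Norming sets for polynomials on the cube\<close>

definition vec_update :: "real ^ 'd \<Rightarrow> 'd \<Rightarrow> real \<Rightarrow> real ^ 'd" where
  "vec_update s i t = (\<chi> j. if j = i then t else s $ j)"

text \<open>The degree is bounded in each coordinate separately, with the others frozen, which is
  what lets the one-variable Markov inequality act coordinate by coordinate.\<close>

definition coordwise_poly :: "nat \<Rightarrow> (real ^ 'd \<Rightarrow> real) \<Rightarrow> bool" where
  "coordwise_poly n f \<longleftrightarrow>
     (\<forall>s i. \<exists>q. degree q \<le> n \<and> (\<forall>t. f (vec_update s i t) = poly q t))"

lemma coordwise_poly_const: "coordwise_poly n (\<lambda>s. c)"
  unfolding coordwise_poly_def by (intro allI exI[of _ "[:c:]"]) auto

lemma coordwise_poly_add:
  assumes "coordwise_poly n f" "coordwise_poly n g"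
  shows "coordwise_poly n (\<lambda>s. f s + g s)"
  unfolding coordwise_poly_def
proof (intro allI)
  fix s :: "real ^ 'a" and i
  obtain p q where "degree p \<le> n" "\<forall>t. f (vec_update s i t) = poly p t"
      "degree q \<le> n" "\<forall>t. g (vec_update s i t) = poly q t"
    using assms unfolding coordwise_poly_def by meson
  then show "\<exists>q. degree q \<le> n \<and> (\<forall>t. f (vec_update s i t) + g (vec_update s i t) = poly q t)"
    by (intro exI[of _ "p + q"]) (auto intro: degree_add_le)
qed

lemma coordwise_poly_cmult:
  assumes "coordwise_poly n f"
  shows "coordwise_poly n (\<lambda>s. c * f s)"
  unfolding coordwise_poly_def
proof (intro allI)
  fix s :: "real ^ 'a" and i
  obtain p where "degree p \<le> n" "\<forall>t. f (vec_update s i t) = poly p t"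
    using assms unfolding coordwise_poly_def by meson
  then show "\<exists>q. degree q \<le> n \<and> (\<forall>t. c * f (vec_update s i t) = poly q t)"
    by (intro exI[of _ "smult c p"]) auto
qed

lemma coordwise_poly_sum:
  assumes "\<And>i. i \<in> I \<Longrightarrow> coordwise_poly n (f i)"
  shows "coordwise_poly n (\<lambda>s. \<Sum>i\<in>I. f i s)"
  using assms
  by (induction I rule: infinite_finite_induct) (auto intro: coordwise_poly_const coordwise_poly_add)

lemma coordwise_poly_signed_sum:
  assumes "\<And>z. coordwise_poly n (\<lambda>s. f s z)"
  shows "coordwise_poly n (\<lambda>s. signed_sum L (f s))"
proof (induction L)
  case (Cons p L)
  then show ?case
    by (cases p) (auto intro!: coordwise_poly_add coordwise_poly_cmult assms)
qed (simp add: coordwise_poly_const)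

text \<open>\<open>s \<bullet> z\<close> is affine in each single coordinate of
  \<open>s\<close>.\<close>

lemma coordwise_poly_inner_power:
  fixes z :: "real ^ 'd"
  assumes "k \<le> n"
  shows "coordwise_poly n (\<lambda>s. (s \<bullet> z) ^ k)"
  unfolding coordwise_poly_def
proof (intro allI)
  fix s :: "real ^ 'd" and i
  let ?p = "[:vec_update s i 0 \<bullet> z, z $ i:]"
  have "(vec_update s i t \<bullet> z) ^ k = poly (?p ^ k) t" for t
  proof -
    have "vec_update s i t = vec_update s i 0 + t *\<^sub>R axis i 1"
      by (simp add: vec_eq_iff vec_update_def axis_def)
    then have "vec_update s i t \<bullet> z = vec_update s i 0 \<bullet> z + t * (axis i 1 \<bullet> z)"
      by (simp only: inner_add_left inner_scaleR_left)
    then have "vec_update s i t \<bullet> z = poly ?p t" by (simp add: inner_axis')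
    then show ?thesis by (simp only: poly_power)
  qed
  moreover have "degree (?p ^ k) \<le> n"
  proof -
    have "degree (?p ^ k) \<le> degree ?p * k" by (rule degree_power_le)
    also have "\<dots> \<le> 1 * k" by (intro mult_right_mono) auto
    finally show ?thesis using assms by simp
  qed
  ultimately show "\<exists>q. degree q \<le> n \<and> (\<forall>t. (vec_update s i t \<bullet> z) ^ k = poly q t)"
    by blast
qed

lemma continuous_on_signed_sum:
  assumes "\<And>z. continuous_on S (\<lambda>s. f s z)"
  shows "continuous_on S (\<lambda>s. signed_sum L (f s))"
proof (induction L)
  case (Cons p L)
  then show ?case
    by (cases p) (auto intro!: continuous_intros assms)
qed simp

lemma coordwise_poly_variation_bound:
  fixes f :: "real ^ 'd \<Rightarrow> real"
  assumes f: "coordwise_poly n f" and M: "\<And>s. s \<in> unit_cube \<Longrightarrow> \<bar>f s\<bar> \<le> M"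
    and x: "x \<in> unit_cube" and y: "y \<in> unit_cube"
  shows "\<bar>f x - f y\<bar> \<le> 32 * real n ^ 2 * M * (\<Sum>i\<in>UNIV. \<bar>x $ i - y $ i\<bar>)"
proof -
  \<comment> \<open>move from \<open>x\<close> to \<open>y\<close> one coordinate at a time, which stays inside the cube\<close>
  define hyb where "hyb I = (\<chi> j. if j \<in> I then y $ j else x $ j)" for I
  have hyb_in: "hyb I \<in> unit_cube" for I
    using x y by (auto simp: hyb_def unit_cube_def)
  have "\<bar>f x - f (hyb I)\<bar> \<le> 32 * real n ^ 2 * M * (\<Sum>i\<in>I. \<bar>x $ i - y $ i\<bar>)" for I
  proof (induction I rule: infinite_finite_induct)
    case (insert i I)
    obtain q where q: "degree q \<le> n" "\<And>t. f (vec_update (hyb I) i t) = poly q t"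
      using f unfolding coordwise_poly_def by meson
    have "vec_update (hyb I) i (x $ i) = hyb I" "vec_update (hyb I) i (y $ i) = hyb (insert i I)"
      using insert(2) by (auto simp: vec_eq_iff vec_update_def hyb_def)
    then have "f (hyb I) = poly q (x $ i)" "f (hyb (insert i I)) = poly q (y $ i)"
      by (metis q(2))+
    moreover have "\<bar>poly q (x $ i) - poly q (y $ i)\<bar> \<le> 32 * real n ^ 2 * M * \<bar>x $ i - y $ i\<bar>"
    proof (rule Markov_variation_bound[OF q(1)])
      fix u :: real assume "u \<in> {0..1}"
      then have "vec_update (hyb I) i u \<in> unit_cube"
        using hyb_in[of I] by (auto simp: unit_cube_def vec_update_def)
      then show "\<bar>poly q u\<bar> \<le> M" using M q(2) by metis
    qed (use x y in \<open>auto simp: unit_cube_def\<close>)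
    ultimately show ?case
      using insert by (simp add: distrib_left)
  qed (simp_all add: hyb_def)
  from this[of UNIV] show ?thesis by (simp add: hyb_def)
qed

lemma compact_unit_cube: "compact (unit_cube :: (real ^ 'd) set)"
proof -
  have "unit_cube = cbox 0 (1 :: real ^ 'd)"
    by (auto simp: unit_cube_def mem_box_cart)
  then show ?thesis by (metis compact_cbox)
qed

lemma zero_in_unit_cube: "0 \<in> unit_cube"
  by (simp add: unit_cube_def)

text \<open>At a maximum point \<open>s\<close> of \<open>\<bar>f\<bar>\<close>, take
  \<open>M = \<bar>f s\<bar>\<close> in the variation bound. The condition on \<open>h\<close> lets
  \<open>f\<close> change by at most \<open>M / 2\<close> between \<open>s\<close> and a nearby
  point of \<open>P\<close>, so the maximum is absorbed.\<close>

lemma coordwise_poly_norming: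
  fixes f :: "real ^ 'd \<Rightarrow> real"
  assumes f: "coordwise_poly n f" and cont: "continuous_on unit_cube f"
    and fill: "\<And>x. x \<in> unit_cube \<Longrightarrow> \<exists>p\<in>P. dist x p \<le> h" and P: "P \<subseteq> unit_cube"
    and h: "64 * real n ^ 2 * real CARD('d) * h \<le> 1"
    and m: "\<And>p. p \<in> P \<Longrightarrow> \<bar>f p\<bar> \<le> m" and x: "x \<in> unit_cube"
  shows "\<bar>f x\<bar> \<le> 2 * m"
proof -
  have "\<exists>s\<in>unit_cube. \<forall>y\<in>unit_cube. \<bar>f y\<bar> \<le> \<bar>f s\<bar>"
    using zero_in_unit_cube
    by (intro continuous_attains_sup compact_unit_cube continuous_intros cont) auto
  then obtain s where s: "s \<in> unit_cube" "\<And>y. y \<in> unit_cube \<Longrightarrow> \<bar>f y\<bar> \<le> \<bar>f s\<bar>"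
    by blast
  obtain p where p: "p \<in> P" "dist s p \<le> h" using fill s(1) by blast
  have "\<bar>f s - f p\<bar> \<le> 32 * real n ^ 2 * \<bar>f s\<bar> * (\<Sum>i\<in>UNIV. \<bar>s $ i - p $ i\<bar>)"
    using s p P by (intro coordwise_poly_variation_bound[OF f]) auto
  also have "(\<Sum>i\<in>UNIV. \<bar>s $ i - p $ i\<bar>) \<le> (\<Sum>i\<in>(UNIV::'d set). h)"
  proof (rule sum_mono)
    fix i
    show "\<bar>s $ i - p $ i\<bar> \<le> h"
      using component_le_norm_cart[of "s - p" i] p(2) by (simp add: dist_norm)
  qed
  also have "32 * real n ^ 2 * \<bar>f s\<bar> * (\<Sum>i\<in>(UNIV::'d set). h)
      = (64 * real n ^ 2 * real CARD('d) * h) * (\<bar>f s\<bar> / 2)"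
    by simp
  also have "\<dots> \<le> 1 * (\<bar>f s\<bar> / 2)"
    using h by (intro mult_right_mono) auto
  finally have "\<bar>f s - f p\<bar> \<le> \<bar>f s\<bar> / 2"
    by (simp add: mult_left_mono)
  then have "\<bar>f s\<bar> \<le> 2 * \<bar>f p\<bar>" by linarith
  then show ?thesis
    using s(2)[OF x] m[OF p(1)] by linarith
qed

section \<open>Evaluation functionals on the RKHS\<close>

text \<open>List form of \<open>h0_rep\<close>, so that \<open>energy\<close> computes the norm on
  H0.\<close>

definition represents :: "('a \<Rightarrow> 'a \<Rightarrow> real) \<Rightarrow> 'a set \<Rightarrow> (real \<times> 'a) list \<Rightarrow> ('a \<Rightarrow> real) \<Rightarrow> bool" where
  "represents K S L g \<longleftrightarrow> snd ` set L \<subseteq> S \<and> (\<forall>x\<in>S. g x = signed_sum L (K x))"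

lemma h0_rep_iff_represents:
  "h0_rep K S g n a z \<longleftrightarrow> represents K S (map (\<lambda>i. (a i, z i)) [0..<n]) g"
  by (auto simp: h0_rep_def represents_def signed_sum_map_upt atLeast0LessThan image_subset_iff)

lemma energy_map_upt:
  "energy K (map (\<lambda>i. (a i, z i)) [m..<n]) = (\<Sum>i=m..<n. \<Sum>j=m..<n. a i * a j * K (z i) (z j))"
  by (simp add: pairing_def signed_sum_map_upt sum_distrib_left mult.assoc)

lemma list_as_map_upt: "\<exists>n a z. L = map (\<lambda>i. (a i, z i)) [0..<n]"
  by (rule exI[of _ "length L"], rule exI[of _ "\<lambda>i. fst (L ! i)"], rule exI[of _ "\<lambda>i. snd (L ! i)"])
     (simp add: map_nth)

lemma in_H0_iff_represents: "in_H0 K S g \<longleftrightarrow> (\<exists>L. represents K S L g)"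
  unfolding in_H0_def h0_rep_iff_represents by (metis list_as_map_upt)

lemma signed_sum_represented:
  assumes "represents K S L g" "snd ` set M \<subseteq> S"
  shows "signed_sum M g = pairing K M L"
  unfolding pairing_def using assms by (intro signed_sum_cong) (auto simp: represents_def)

text \<open>Two lists representing the same function have equal energies, both being equal to their
  pairing, so the infimum ranges over a single value.\<close>

lemma h0_norm_represented:
  assumes K: "psd_kernel K" and L: "represents K S L g"
  shows "h0_norm K S g = sqrt (energy K L)"
proof -
  have en: "energy K M = energy K L" if M: "represents K S M g" for M
  proof -
    have "energy K M = signed_sum M g"
      using M by (intro signed_sum_represented[OF M, symmetric]) (simp add: represents_def)
    also have "\<dots> = pairing K M L"
      using M by (intro signed_sum_represented[OF L]) (simp add: represents_def)
    also have "\<dots> = pairing K L M"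
      by (rule pairing_commute[OF K])
    also have "\<dots> = signed_sum L g"
      using L by (intro signed_sum_represented[OF M, symmetric]) (simp add: represents_def)
    also have "\<dots> = energy K L"
      using L by (intro signed_sum_represented[OF L]) (simp add: represents_def)
    finally show ?thesis .
  qed
  have "{sqrt (\<Sum>i<n. \<Sum>j<n. a i * a j * K (z i) (z j)) | n a z. h0_rep K S g n a z} =
        {sqrt (energy K (map (\<lambda>i. (a i, z i)) [0..<n])) | n a z.
           represents K S (map (\<lambda>i. (a i, z i)) [0..<n]) g}"
    by (simp add: energy_map_upt h0_rep_iff_represents atLeast0LessThan)
  also have "\<dots> = {sqrt (energy K L)}"
  proof -
    obtain n a z where "L = map (\<lambda>i. (a i, z i)) [0..<n]"
      using list_as_map_upt by blast
    then have "sqrt (energy K L) = sqrt (energy K (map (\<lambda>i. (a i, z i)) [0..<n])) \<and>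
        represents K S (map (\<lambda>i. (a i, z i)) [0..<n]) g"
      using L by simp
    then have "sqrt (energy K L) \<in> {sqrt (energy K (map (\<lambda>i. (a i, z i)) [0..<n])) | n a z.
           represents K S (map (\<lambda>i. (a i, z i)) [0..<n]) g}"
      unfolding mem_Collect_eq by (intro exI)
    moreover have "{sqrt (energy K (map (\<lambda>i. (a i, z i)) [0..<n])) | n a z.
           represents K S (map (\<lambda>i. (a i, z i)) [0..<n]) g} \<subseteq> {sqrt (energy K L)}"
      using en by auto
    ultimately show ?thesis by (intro subset_antisym) auto
  qed
  finally show ?thesis by (simp add: h0_norm_def)
qed

lemma signed_sum_le_h0_norm:
  assumes K: "psd_kernel K" and g: "in_H0 K S g" and M: "snd ` set M \<subseteq> S"
  shows "\<bar>signed_sum M g\<bar> \<le> h0_norm K S g * sqrt (energy K M)"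
proof -
  obtain L where L: "represents K S L g"
    using g in_H0_iff_represents by blast
  show ?thesis
    unfolding signed_sum_represented[OF L M] h0_norm_represented[OF K L]
    using pairing_Cauchy_Schwarz[OF K, of M L] by (simp add: mult.commute)
qed

lemma h0_norm_diff_le:
  assumes K: "psd_kernel K" and "in_H0 K S g" "in_H0 K S g'"
  shows "h0_norm K S g \<le> h0_norm K S (\<lambda>x. g x - g' x) + h0_norm K S g'"
proof -
  obtain L L' where L: "represents K S L g" and L': "represents K S L' g'"
    using assms in_H0_iff_represents by blast
  let ?D = "L @ scale (- 1) L'"
  \<comment> \<open>Appending \<open>L'\<close> to \<open>?D\<close> cancels the subtracted copy and
    gives another representation of \<open>g\<close>, to which the energy triangle inequality
    applies.\<close>
  have D: "represents K S ?D (\<lambda>x. g x - g' x)" and E: "represents K S (?D @ scale 1 L') g"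
    using L L' by (auto simp: represents_def signed_sum_append signed_sum_scale image_Un)
  show ?thesis
    unfolding h0_norm_represented[OF K D] h0_norm_represented[OF K E] h0_norm_represented[OF K L']
    using sqrt_energy_triangle[OF K, of ?D 1 L'] by simp
qed

text \<open>The reverse triangle inequality makes the norms a Cauchy sequence; hence the set in
  \<open>rkhs_norm\<close> is nonempty.\<close>

lemma rkhs_approx_norm_convergent:
  assumes K: "psd_kernel K" and g: "rkhs_approx K S f g"
  shows "\<exists>r. (\<lambda>n. h0_norm K S (g n)) \<longlonglongrightarrow> r"
proof -
  have H: "in_H0 K S (g n)" for n
    using g by (simp add: rkhs_approx_def)
  have "Cauchy (\<lambda>n. h0_norm K S (g n))"
    unfolding Cauchy_def
  proof (intro allI impI)
    fix e :: real assume "e > 0"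
    then obtain N where N: "\<And>m n. m \<ge> N \<Longrightarrow> n \<ge> N \<Longrightarrow> h0_norm K S (\<lambda>x. g m x - g n x) < e"
      using g unfolding rkhs_approx_def by meson
    have "dist (h0_norm K S (g m)) (h0_norm K S (g n)) < e" if "m \<ge> N" "n \<ge> N" for m n
      using N[OF that] N[OF that(2,1)] h0_norm_diff_le[OF K H[of m] H[of n]]
        h0_norm_diff_le[OF K H[of n] H[of m]]
      by (simp add: dist_real_def abs_less_iff)
    then show "\<exists>M. \<forall>m\<ge>M. \<forall>n\<ge>M. dist (h0_norm K S (g m)) (h0_norm K S (g n)) < e"
      by blast
  qed
  then show ?thesis
    using Cauchy_convergent_iff convergent_def by blast
qed

text \<open>The bound on H0 passes to the pointwise limits that form the RKHS, and then to the
  infimum of the limiting norms.\<close>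

lemma signed_sum_rkhs_ball_le:
  assumes K: "psd_kernel K" and f: "f \<in> rkhs_ball K S B" and M: "snd ` set M \<subseteq> S"
  shows "\<bar>signed_sum M f\<bar> \<le> B * sqrt (energy K M)"
proof -
  let ?R = "{r. \<exists>g. rkhs_approx K S f g \<and> (\<lambda>n. h0_norm K S (g n)) \<longlonglongrightarrow> r}"
  have le: "\<bar>signed_sum M f\<bar> \<le> r * sqrt (energy K M)" if "r \<in> ?R" for r
  proof -
    from that obtain g where g: "rkhs_approx K S f g" "(\<lambda>n. h0_norm K S (g n)) \<longlonglongrightarrow> r"
      by blast
    have "(\<lambda>n. \<bar>signed_sum M (g n)\<bar>) \<longlonglongrightarrow> \<bar>signed_sum M f\<bar>"
      using g(1) M by (intro tendsto_rabs signed_sum_tendsto) (auto simp: rkhs_approx_def)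
    moreover have "(\<lambda>n. h0_norm K S (g n) * sqrt (energy K M)) \<longlonglongrightarrow> r * sqrt (energy K M)"
      by (intro tendsto_intros g(2))
    ultimately show ?thesis
      by (rule LIMSEQ_le) (use g(1) signed_sum_le_h0_norm[OF K _ M] in \<open>auto simp: rkhs_approx_def\<close>)
  qed
  \<comment> \<open>The \<open>Inf\<close> of an empty set of reals would say nothing about
    \<open>f\<close>.\<close>
  have ne: "?R \<noteq> {}"
  proof -
    obtain g where g: "rkhs_approx K S f g"
      using f by (auto simp: rkhs_ball_def in_rkhs_def)
    then show ?thesis using rkhs_approx_norm_convergent[OF K g] by blast
  qed
  have norm: "Inf ?R \<le> B"
    using f by (simp add: rkhs_ball_def rkhs_norm_def)
  show ?thesis
  proof (cases "energy K M = 0")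
    case True
    \<comment> \<open>Division by the energy is impossible here, but a single \<open>r\<close>
      already forces the sum to vanish.\<close>
    then show ?thesis using ne le by fastforce
  next
    case False
    then have pos: "sqrt (energy K M) > 0"
      using psd_kernel_energy[OF K, of M] by simp
    have "\<bar>signed_sum M f\<bar> / sqrt (energy K M) \<le> Inf ?R"
      using ne le pos by (intro cInf_greatest) (auto simp: divide_le_eq)
    with norm have "\<bar>signed_sum M f\<bar> / sqrt (energy K M) \<le> B" by simp
    with pos show ?thesis by (simp add: divide_le_eq)
  qed
qed

section \<open>Definiteness and the inverse Gram matrix\<close>

text \<open>
  Along the ray through a center \<open>m\<close> of maximal norm the section at \<open>m\<close> dominates all the others.
\<close>

lemma se_kernel_sections_independent:
  fixes F :: "'a::euclidean_space set"
  assumes l: "l \<noteq> 0" and F: "finite F" and zero: "\<And>s. (\<Sum>x\<in>F. w x * se_kernel l s x) = 0"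
    and x: "x \<in> F"
  shows "w x = 0"
proof (rule ccontr)
  assume "w x \<noteq> 0"
  define G where "G = {x \<in> F. w x \<noteq> 0}"
  have G: "finite G" "G \<noteq> {}"
    using F x \<open>w x \<noteq> 0\<close> by (auto simp: G_def)
  obtain m where m: "m \<in> G" "\<And>y. y \<in> G \<Longrightarrow> norm y \<le> norm m"
  proof -
    have "Max (norm ` G) \<in> norm ` G" using G by simp
    then obtain m where "m \<in> G" "norm m = Max (norm ` G)" by auto
    then show thesis using that[of m] G by simp
  qed
  \<comment> \<open>Follows from \<open>(y - m) \<bullet> (y - m) > 0\<close> and the maximality of
    \<open>norm m\<close>.\<close>
  have inner_less: "m \<bullet> y < m \<bullet> m" if "y \<in> G" "y \<noteq> m" for y
  proof -
    have "(y - m) \<bullet> (y - m) > 0" using that by simp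
    then have "2 * (m \<bullet> y) < y \<bullet> y + m \<bullet> m"
      by (simp add: inner_diff inner_commute)
    also have "y \<bullet> y \<le> m \<bullet> m"
      using m(2)[OF that(1)] by (simp add: norm_eq_sqrt_inner)
    finally show ?thesis by simp
  qed
  \<comment> \<open>Evaluate at \<open>n\<close> times \<open>m\<close> and divide out the factor of
    the section at \<open>m\<close> that depends on \<open>n\<close>. The term at \<open>y\<close>
    becomes geometric, with ratio below 1 unless \<open>y = m\<close>.\<close>
  have sum0: "(\<Sum>y\<in>G. w y * gauss l y * exp ((m \<bullet> y - m \<bullet> m) / l\<^sup>2) ^ n) = 0" for n
  proof -
    have "0 = (\<Sum>y\<in>F. w y * se_kernel l (real n *\<^sub>R m) y)"
      using zero by simp
    also have "\<dots> = (\<Sum>y\<in>G. w y * se_kernel l (real n *\<^sub>R m) y)"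
      unfolding G_def using F by (intro sum.mono_neutral_right) auto
    also have "\<dots> = (\<Sum>y\<in>G. (gauss l (real n *\<^sub>R m) * exp (real n * (m \<bullet> m) / l\<^sup>2)) *
         (w y * gauss l y * exp ((m \<bullet> y - m \<bullet> m) / l\<^sup>2) ^ n))"
    proof (rule sum.cong)
      fix y
      have "exp (real n * (m \<bullet> y) / l\<^sup>2)
          = exp (real n * (m \<bullet> m) / l\<^sup>2) * exp ((m \<bullet> y - m \<bullet> m) / l\<^sup>2) ^ n"
        by (simp add: exp_of_nat_mult[symmetric] exp_add[symmetric] diff_divide_distrib right_diff_distrib)
      then show "w y * se_kernel l (real n *\<^sub>R m) y = (gauss l (real n *\<^sub>R m) * exp (real n * (m \<bullet> m) / l\<^sup>2)) *
         (w y * gauss l y * exp ((m \<bullet> y - m \<bullet> m) / l\<^sup>2) ^ n)"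
        by (simp add: se_kernel_eq[OF l])
    qed simp
    also have "\<dots> = (gauss l (real n *\<^sub>R m) * exp (real n * (m \<bullet> m) / l\<^sup>2)) *
         (\<Sum>y\<in>G. w y * gauss l y * exp ((m \<bullet> y - m \<bullet> m) / l\<^sup>2) ^ n)"
      by (simp add: sum_distrib_left)
    finally show ?thesis
      using gauss_pos[of l "real n *\<^sub>R m"] by simp
  qed
  have "(\<lambda>n. \<Sum>y\<in>G. w y * gauss l y * exp ((m \<bullet> y - m \<bullet> m) / l\<^sup>2) ^ n)
          \<longlonglongrightarrow> (\<Sum>y\<in>G. if y = m then w m * gauss l m else 0)"
  proof (rule tendsto_sum)
    fix y assume y: "y \<in> G"
    show "(\<lambda>n. w y * gauss l y * exp ((m \<bullet> y - m \<bullet> m) / l\<^sup>2) ^ n)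
            \<longlonglongrightarrow> (if y = m then w m * gauss l m else 0)"
    proof (cases "y = m")
      case False
      then have "(\<lambda>n. exp ((m \<bullet> y - m \<bullet> m) / l\<^sup>2) ^ n) \<longlonglongrightarrow> 0"
        using inner_less[OF y False] l by (intro LIMSEQ_power_zero) (simp add: divide_neg_pos)
      then show ?thesis
        using False tendsto_mult_right_zero by fastforce
    qed simp
  qed
  then have "(\<lambda>n. 0 :: real) \<longlonglongrightarrow> (\<Sum>y\<in>G. if y = m then w m * gauss l m else 0)"
    by (simp only: sum0)
  moreover have "(\<Sum>y\<in>G. if y = m then w m * gauss l m else 0) = w m * gauss l m"
    using G m(1) by simp
  ultimately have "w m * gauss l m = 0"
    by (metis LIMSEQ_const_iff)
  then show False
    using m(1) gauss_pos[of l m] by (simp add: G_def)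
qed

text \<open>Elimination by bordering: the smaller system is solved by induction, and definiteness
  keeps the Schur complement \<open>s\<close> of the new pivot nonzero.\<close>

lemma definite_system_solvable:
  fixes K :: "'i \<Rightarrow> 'i \<Rightarrow> real"
  assumes "finite I"
    and "\<And>v. (\<Sum>i\<in>I. \<Sum>j\<in>I. v i * v j * K i j) = 0 \<Longrightarrow> \<forall>i\<in>I. v i = 0"
  shows "\<exists>v. \<forall>i\<in>I. (\<Sum>j\<in>I. K i j * v j) = b i"
  using assms
proof (induction I arbitrary: b rule: finite_induct)
  case (insert p I)
  have sum_upd: "(\<Sum>j\<in>I. g j (if j = p then a else v j)) = (\<Sum>j\<in>I. g j (v j))"
    for g :: "'i \<Rightarrow> real \<Rightarrow> real" and a and v :: "'i \<Rightarrow> real"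
    using insert(2) by (intro sum.cong) auto
  have definite: "\<forall>i\<in>I. v i = 0" if v: "(\<Sum>i\<in>I. \<Sum>j\<in>I. v i * v j * K i j) = 0" for v
  proof -
    let ?v = "\<lambda>i. if i = p then 0 else v i"
    have "(\<Sum>i\<in>I. \<Sum>j\<in>I. ?v i * ?v j * K i j) = (\<Sum>i\<in>I. \<Sum>j\<in>I. v i * v j * K i j)"
      using insert(2) by (intro sum.cong) auto
    then have "(\<Sum>i\<in>insert p I. \<Sum>j\<in>insert p I. ?v i * ?v j * K i j) = 0"
      using insert(1,2) v by simp
    then have "\<forall>i\<in>insert p I. ?v i = 0" by (rule insert.prems)
    then show ?thesis using insert(2) by (metis insertCI)
  qed
  have IH: "\<exists>v. \<forall>i\<in>I. (\<Sum>j\<in>I. K i j * v j) = b' i" for b'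
    by (rule insert.IH) (rule definite)
  obtain c where c: "\<And>i. i \<in> I \<Longrightarrow> (\<Sum>j\<in>I. K i j * c j) = K i p"
    using IH[of "\<lambda>i. K i p"] by blast
  obtain y where y: "\<And>i. i \<in> I \<Longrightarrow> (\<Sum>j\<in>I. K i j * y j) = b i"
    using IH[of b] by blast
  define s where "s = K p p - (\<Sum>j\<in>I. K p j * c j)"
  have "s \<noteq> 0"
  proof
    assume s: "s = 0"
    \<comment> \<open>If \<open>s\<close> vanished, every row would annihilate this vector, although
      its entry at \<open>p\<close> is 1.\<close>
    let ?v = "\<lambda>j. if j = p then 1 else - c j"
    have "(\<Sum>j\<in>insert p I. K i j * ?v j) = 0" if "i \<in> insert p I" for i
    proof -
      have "(\<Sum>j\<in>insert p I. K i j * ?v j) = K i p - (\<Sum>j\<in>I. K i j * c j)"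
        using insert(1,2) sum_upd[of "\<lambda>j. (*) (K i j)" 1 "\<lambda>j. - c j"] by (simp add: sum_negf)
      then show ?thesis using that c s by (auto simp: s_def)
    qed
    then have "(\<Sum>i\<in>insert p I. ?v i * (\<Sum>j\<in>insert p I. K i j * ?v j)) = 0"
      by simp
    then have "(\<Sum>i\<in>insert p I. \<Sum>j\<in>insert p I. ?v i * ?v j * K i j) = 0"
      by (simp only: sum_distrib_left mult_ac)
    then have "\<forall>i\<in>insert p I. ?v i = 0" by (rule insert.prems)
    then show False by auto
  qed
  \<comment> \<open>Row \<open>p\<close> determines \<open>r\<close>; subtracting
    \<open>r * c\<close> compensates for column \<open>p\<close> in the other rows.\<close>
  define r where "r = (b p - (\<Sum>j\<in>I. K p j * y j)) / s"
  let ?v = "\<lambda>j. if j = p then r else y j - r * c j"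
  have "(\<Sum>j\<in>insert p I. K i j * ?v j)
      = (\<Sum>j\<in>I. K i j * y j) + r * (K i p - (\<Sum>j\<in>I. K i j * c j))" for i
    using insert(1,2) sum_upd[of "\<lambda>j. (*) (K i j)" r "\<lambda>j. y j - r * c j"]
    by (simp add: algebra_simps sum_subtractf sum_distrib_left)
  then have "\<forall>i\<in>insert p I. (\<Sum>j\<in>insert p I. K i j * ?v j) = b i"
    using c y \<open>s \<noteq> 0\<close> by (auto simp: r_def simp flip: s_def)
  then show ?case by (intro exI[of _ ?v])
qed simp

text \<open>The definite description needs a unique witness. Solving for unit vectors gives a right
  inverse; injectivity of \<open>K\<close> makes it a left inverse and yields uniqueness, with the
  zero convention fixing the entries outside the range.\<close>

lemma mat_inv_n_left:
  assumes sym: "\<And>i j. K i j = K j i"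
    and def: "\<And>v. (\<Sum>i\<in>{1..n}. \<Sum>j\<in>{1..n}. v i * v j * K i j) = 0 \<Longrightarrow> \<forall>i\<in>{1..n}. v i = 0"
    and i: "i \<in> {1..n}" and j: "j \<in> {1..n}"
  shows "(\<Sum>l\<in>{1..n}. mat_inv_n n K i l * K l j) = (if i = j then 1 else 0)"
proof -
  let ?I = "{1..n}"
  let ?R = "\<lambda>M. \<forall>i\<in>?I. \<forall>j\<in>?I. (\<Sum>l\<in>?I. K i l * M l j) = (if i = j then 1 else 0)"
  let ?L = "\<lambda>M. \<forall>i\<in>?I. \<forall>j\<in>?I. (\<Sum>l\<in>?I. M i l * K l j) = (if i = j then 1 else 0)"
  let ?Z = "\<lambda>M :: nat \<Rightarrow> nat \<Rightarrow> real. \<forall>i j. \<not> (i \<in> ?I \<and> j \<in> ?I) \<longrightarrow> M i j = 0"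
  have inj: "\<forall>i\<in>?I. v i = 0" if "\<And>i. i \<in> ?I \<Longrightarrow> (\<Sum>j\<in>?I. K i j * v j) = 0" for v
  proof (rule def)
    have "(\<Sum>i\<in>?I. v i * (\<Sum>j\<in>?I. K i j * v j)) = 0"
      using that by simp
    then show "(\<Sum>i\<in>?I. \<Sum>j\<in>?I. v i * v j * K i j) = 0"
      by (simp only: sum_distrib_left mult_ac)
  qed
  have "\<exists>V. \<forall>j. \<forall>i\<in>?I. (\<Sum>l\<in>?I. K i l * V j l) = (if i = j then 1 else 0)"
  proof (rule choice, rule allI)
    fix j
    show "\<exists>v. \<forall>i\<in>?I. (\<Sum>l\<in>?I. K i l * v l) = (if i = j then 1 else 0)"
      by (rule definite_system_solvable) (use def in auto)
  qed
  then obtain V where V: "\<And>j i. i \<in> ?I \<Longrightarrow> (\<Sum>l\<in>?I. K i l * V j l) = (if i = j then 1 else 0)"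
    by blast
  define M where "M i j = (if i \<in> ?I \<and> j \<in> ?I then V j i else 0)" for i j
  have R: "?R M"
  proof (intro ballI)
    fix i j assume ij: "i \<in> ?I" "j \<in> ?I"
    have "(\<Sum>l\<in>?I. K i l * M l j) = (\<Sum>l\<in>?I. K i l * V j l)"
      using ij by (intro sum.cong) (auto simp: M_def)
    then show "(\<Sum>l\<in>?I. K i l * M l j) = (if i = j then 1 else 0)"
      using V ij by simp
  qed
  have L: "?L M"
  proof (intro ballI)
    fix i j assume ij: "i \<in> ?I" "j \<in> ?I"
    \<comment> \<open>Column \<open>j\<close> of \<open>M K - 1\<close>, which \<open>K\<close> maps
      to zero because \<open>K M = 1\<close>.\<close>
    let ?v = "\<lambda>m. (\<Sum>l\<in>?I. M m l * K l j) - (if m = j then 1 else 0)"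
    have "(\<Sum>m\<in>?I. K a m * ?v m) = 0" if a: "a \<in> ?I" for a
    proof -
      have "(\<Sum>m\<in>?I. K a m * (\<Sum>l\<in>?I. M m l * K l j)) = (\<Sum>l\<in>?I. (\<Sum>m\<in>?I. K a m * M m l) * K l j)"
        unfolding sum_distrib_left sum_distrib_right by (subst sum.swap) (simp only: mult.assoc)
      also have "\<dots> = (\<Sum>l\<in>?I. (if a = l then 1 else 0) * K l j)"
        using R a by (intro sum.cong) auto
      also have "\<dots> = (\<Sum>l\<in>?I. if l = a then K a j else 0)"
        by (intro sum.cong) auto
      also have "\<dots> = K a j"
        using a by simp
      finally have "(\<Sum>m\<in>?I. K a m * (\<Sum>l\<in>?I. M m l * K l j)) = K a j" .
      moreover have "(\<Sum>m\<in>?I. K a m * (if m = j then 1 else 0)) = K a j"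
      proof -
        have "(\<Sum>m\<in>?I. K a m * (if m = j then 1 else 0)) = (\<Sum>m\<in>?I. if m = j then K a j else 0)"
          by (intro sum.cong) auto
        then show ?thesis using ij by simp
      qed
      ultimately show ?thesis
        by (simp only: right_diff_distrib sum_subtractf)
    qed
    then have "?v i = 0" using inj[of ?v] ij by blast
    then show "(\<Sum>l\<in>?I. M i l * K l j) = (if i = j then 1 else 0)" by linarith
  qed
  have uniq: "M' = M" if "?R M'" "?Z M'" for M'
  proof (intro ext)
    fix i j
    show "M' i j = M i j"
    proof (cases "i \<in> ?I \<and> j \<in> ?I")
      case True
      have "(\<Sum>m\<in>?I. K a m * (M' m j - M m j)) = 0" if "a \<in> ?I" for a
        using \<open>?R M'\<close> R True that by (simp add: right_diff_distrib sum_subtractf)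
      then show ?thesis using inj[of "\<lambda>m. M' m j - M m j"] True by auto
    next
      case False
      then show ?thesis using \<open>?Z M'\<close> unfolding M_def by presburger
    qed
  qed
  have Z: "?Z M"
    by (simp add: M_def)
  have "(THE M. ?R M \<and> ?L M \<and> ?Z M) = M"
  proof (rule the_equality[where P = "\<lambda>M. ?R M \<and> ?L M \<and> ?Z M"])
    show "?R M \<and> ?L M \<and> ?Z M"
      by (intro conjI R L Z)
    fix M' assume M': "?R M' \<and> ?L M' \<and> ?Z M'"
    have "?R M'" by (rule conjunct1[OF M'])
    moreover have "?Z M'" by (rule conjunct2[OF conjunct2[OF M']])
    ultimately show "M' = M" by (rule uniq)
  qed
  then have "mat_inv_n n K = M"
    by (simp only: mat_inv_n_def)
  then show ?thesis using L i j by simp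
qed

text \<open>By Cauchy-Schwarz a measure of zero energy annihilates every kernel section, and
  sections at distinct points are independent.\<close>

lemma gram_se_kernel_definite:
  fixes xs :: "nat \<Rightarrow> 'a::euclidean_space"
  assumes l: "l \<noteq> 0" and inj: "inj_on xs {1..n}"
    and v: "(\<Sum>i\<in>{1..n}. \<Sum>j\<in>{1..n}. v i * v j * gram (se_kernel l) xs i j) = 0"
  shows "\<forall>i\<in>{1..n}. v i = 0"
proof
  fix i assume i: "i \<in> {1..n}"
  let ?L = "map (\<lambda>i. (v i, xs i)) [1..<Suc n]"
  have I: "{1..<Suc n} = {1..n}" by auto
  have "energy (se_kernel l) ?L = 0"
    unfolding energy_map_upt I using v by (simp add: gram_def)
  then have zero: "(\<Sum>j\<in>{1..n}. v j * se_kernel l s (xs j)) = 0" for s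
    using signed_sum_kernel_le[OF psd_se_kernel[OF l], of ?L s] by (simp only: signed_sum_map_upt I) simp
  \<comment> \<open>Independence concerns a set of centers, so the weights are carried from indices
    to points.\<close>
  have "(\<Sum>x\<in>xs ` {1..n}. v (the_inv_into {1..n} xs x) * se_kernel l s x) = 0" for s
    using zero[of s] inj by (simp add: sum.reindex the_inv_into_f_f)
  then have "v (the_inv_into {1..n} xs (xs i)) = 0"
    using se_kernel_sections_independent[OF l, where F = "xs ` {1..n}" and x = "xs i"
        and w = "\<lambda>x. v (the_inv_into {1..n} xs x)"] i by simp
  then show "v i = 0"
    using inj i by (simp add: the_inv_into_f_f)
qed

section \<open>The rate\<close>

text \<open>One term of a nonnegative series; at \<open>a = n\<close> it reads
  \<open>n! \<ge> (n/e)^n\<close>.\<close>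

lemma power_div_fact_le_exp:
  assumes "(a::real) \<ge> 0" shows "a ^ n / fact n \<le> exp a"
proof -
  have "(\<lambda>n. a ^ n / fact n) sums exp a"
    using exp_converges[of a] by (simp add: divide_inverse mult.commute)
  then have "(\<Sum>k\<in>{n}. a ^ k / fact k) \<le> exp a"
    using assms sum_le_suminf[of "\<lambda>n. a ^ n / fact n" "{n}"] by (auto simp: sums_iff)
  then show ?thesis by simp
qed

text \<open>Take the largest \<open>N\<close> that the first condition permits, of order
  \<open>1 / (b * sqrt h)\<close>. Then \<open>A ^ N / fact N \<le> (exp 1 * A / N) ^ N\<close>,
  whose base is at most \<open>h powr (1 / 4)\<close> for small \<open>h\<close>.\<close>

lemma exp_tail_rate:
  fixes A b :: real
  assumes A: "A > 0" and b: "b > 0"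
  shows "\<exists>c>0. \<exists>h0>0. \<forall>h. 0 < h \<and> h < h0 \<longrightarrow>
    (\<exists>N::nat. (b * real N)\<^sup>2 * h \<le> 1 \<and>
       6 * sqrt (exp A * A ^ N / fact N) \<le> exp (c * ln h / (2 * sqrt h)))"
proof -
  \<comment> \<open>The square root leaves the exponent \<open>ln h / (16 * b * sqrt h)\<close>.
    Half of it is the rate; the other half absorbs 6 and \<open>exp (A / 2)\<close>.\<close>
  define c where "c = 1 / (16 * b)"
  have "filterlim (\<lambda>h::real. - ln h / sqrt h) at_top (at_right 0)"
    by real_asymp
  then have e1: "\<forall>\<^sub>F h in at_right 0. 32 * b * (ln 6 + A / 2) \<le> - ln h / sqrt h"
    by (simp add: filterlim_at_top)
  have "filterlim (\<lambda>h::real. h powr (- 1 / 4)) at_top (at_right 0)"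
    by real_asymp
  then have e2: "\<forall>\<^sub>F h in at_right 0. 2 * b * exp 1 * A \<le> h powr (- 1 / 4)"
    by (simp add: filterlim_at_top)
  have "filterlim (\<lambda>h::real. 1 / sqrt h) at_top (at_right 0)"
    by real_asymp
  then have e3: "\<forall>\<^sub>F h in at_right 0. 2 * b \<le> 1 / sqrt h"
    by (simp add: filterlim_at_top)
  have e4: "\<forall>\<^sub>F h in at_right (0::real). h < 1"
    by real_asymp
  have "\<forall>\<^sub>F h in at_right 0. 32 * b * (ln 6 + A / 2) \<le> - ln h / sqrt h \<and>
      2 * b * exp 1 * A \<le> h powr (- 1 / 4) \<and> 2 * b \<le> 1 / sqrt h \<and> h < 1"
    using e1 e2 e3 e4 by eventually_elim auto
  then obtain h0 where h0: "h0 > 0" "\<And>h. 0 < h \<Longrightarrow> h < h0 \<Longrightarrow>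
      32 * b * (ln 6 + A / 2) \<le> - ln h / sqrt h \<and>
      2 * b * exp 1 * A \<le> h powr (- 1 / 4) \<and> 2 * b \<le> 1 / sqrt h \<and> h < 1"
    unfolding eventually_at_right_field by blast
  have "\<exists>N::nat. (b * real N)\<^sup>2 * h \<le> 1 \<and>
       6 * sqrt (exp A * A ^ N / fact N) \<le> exp (c * ln h / (2 * sqrt h))"
    if h: "0 < h" "h < h0" for h
  proof -
    define y where "y = 1 / (b * sqrt h)"
    define N where "N = nat \<lfloor>y\<rfloor>"
    note H = h0(2)[OF h]
    have y: "y \<ge> 2"
      using H b h by (simp add: y_def field_simps)
    have "real N = of_int \<lfloor>y\<rfloor>"
      using y by (simp add: N_def)
    \<comment> \<open>Rounding down costs at most 1, which is at most \<open>y / 2\<close> because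
      \<open>y \<ge> 2\<close>.\<close>
    then have N_le: "real N \<le> y" and N_ge: "y / 2 \<le> real N"
      using y by linarith+
    then have N_pos: "real N > 0" using y by linarith
    have "b * real N * sqrt h \<le> b * y * sqrt h"
      using N_le b h by (intro mult_right_mono mult_left_mono) auto
    also have "\<dots> = 1"
      using b h by (simp add: y_def)
    finally have "(b * real N * sqrt h)\<^sup>2 \<le> 1\<^sup>2"
      using b h by (intro power_mono) auto
    then have first: "(b * real N)\<^sup>2 * h \<le> 1"
      using h by (simp add: power_mult_distrib)
    have ratio: "exp 1 * A / real N \<le> h powr (1 / 4)"
    proof -
      have "exp 1 * A / real N \<le> exp 1 * A / (y / 2)"
        using N_ge N_pos y A by (intro divide_left_mono) auto
      also have "\<dots> = (2 * b * exp 1 * A) * sqrt h"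
        using b h by (simp add: y_def)
      also have "\<dots> \<le> h powr (- 1 / 4) * sqrt h"
        using H h by (intro mult_right_mono) auto
      also have "\<dots> = h powr (1 / 4)"
        using h by (simp add: powr_half_sqrt[symmetric] powr_add[symmetric])
      finally show ?thesis .
    qed
    have "A ^ N / fact N = (exp 1 * A / real N) ^ N * (real N ^ N / fact N) / exp (real N)"
      using N_pos by (simp add: power_divide power_mult_distrib exp_of_nat_mult[of N 1, simplified])
    also have "\<dots> \<le> (exp 1 * A / real N) ^ N"
    proof -
      have "(exp 1 * A / real N) ^ N * (real N ^ N / fact N) \<le> (exp 1 * A / real N) ^ N * exp (real N)"
        using A by (intro mult_left_mono power_div_fact_le_exp) auto
      then show ?thesis by (simp only: pos_divide_le_eq[OF exp_gt_zero])
    qed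
    also have "\<dots> \<le> (h powr (1 / 4)) ^ N"
      using ratio A by (intro power_mono) auto
    also have "\<dots> = exp (real N * ln h / 4)"
      using h by (simp add: powr_def exp_of_nat_mult[symmetric])
    also have "\<dots> \<le> exp (ln h / (8 * b * sqrt h))"
    proof -
      \<comment> \<open>Since \<open>ln h\<close> is negative, the lower bound on \<open>N\<close>
        is the one that gives an upper bound.\<close>
      have "ln h < 0" using h H by simp
      then have "real N * ln h \<le> y / 2 * ln h"
        using N_ge by (intro mult_right_mono_neg) auto
      then show ?thesis by (simp add: y_def)
    qed
    finally have main: "A ^ N / fact N \<le> exp (ln h / (8 * b * sqrt h))" .
    have "exp A * A ^ N / fact N \<le> exp A * exp (ln h / (8 * b * sqrt h))"
      using main by (simp flip: times_divide_eq_right)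
    also have "\<dots> = (exp (A / 2 + ln h / (16 * b * sqrt h)))\<^sup>2"
      by (simp add: exp_add[symmetric] power2_eq_square)
    finally have "sqrt (exp A * A ^ N / fact N) \<le> exp (A / 2 + ln h / (16 * b * sqrt h))"
      by (intro real_le_lsqrt) auto
    then have "6 * sqrt (exp A * A ^ N / fact N) \<le> exp (ln 6 + (A / 2 + ln h / (16 * b * sqrt h)))"
      by (simp add: exp_add)
    also have "\<dots> \<le> exp (c * ln h / (2 * sqrt h))"
    proof -
      have "ln 6 + A / 2 \<le> (- ln h / sqrt h) / (32 * b)"
        using H b by (subst pos_le_divide_eq) (auto simp: mult.commute)
      also have "\<dots> = - (ln h / (32 * b * sqrt h))" by (simp add: mult_ac)
      finally have 1: "ln 6 + A / 2 \<le> - (ln h / (32 * b * sqrt h))" .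
      have 2: "ln h / (16 * b * sqrt h) = 2 * (ln h / (32 * b * sqrt h))"
        by simp
      have 3: "c * ln h / (2 * sqrt h) = ln h / (32 * b * sqrt h)"
        by (simp add: c_def)
      show ?thesis using 1 unfolding exp_le_cancel_iff 2 3 by linarith
    qed
    finally show ?thesis using first by blast
  qed
  moreover have "c > 0" using b by (simp add: c_def)
  ultimately show ?thesis using h0(1) by blast
qed

section \<open>Posterior variance and regret\<close>

text \<open>The signed measure whose value on \<open>g\<close> is \<open>g x\<close> minus the interpolant of \<open>g\<close> at \<open>x\<close>.\<close>

definition residual :: "('a \<Rightarrow> 'a \<Rightarrow> real) \<Rightarrow> (nat \<Rightarrow> 'a) \<Rightarrow> nat \<Rightarrow> 'a \<Rightarrow> (real \<times> 'a) list" where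
  "residual K xs n x = (1, x) #
     map (\<lambda>j. (- (\<Sum>i\<in>{1..n}. K x (xs i) * mat_inv_n n (gram K xs) i j), xs j)) [1..<Suc n]"

lemma signed_sum_residual:
  "signed_sum (residual K xs n x) f =
     f x - (\<Sum>i\<in>{1..n}. \<Sum>j\<in>{1..n}. K x (xs i) * mat_inv_n n (gram K xs) i j * f (xs j))"
proof -
  have I: "{1..<Suc n} = {1..n}" by auto
  have "signed_sum (residual K xs n x) f = f x -
      (\<Sum>j\<in>{1..n}. \<Sum>i\<in>{1..n}. K x (xs i) * mat_inv_n n (gram K xs) i j * f (xs j))"
    unfolding residual_def signed_sum_Cons signed_sum_map_upt I
    by (simp add: sum_negf sum_distrib_right)
  then show ?thesis by (subst sum.swap)
qed

lemma snd_set_residual: "snd ` set (residual K xs n x) = insert x (xs ` {1..n})"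
  by (auto simp: residual_def image_image)

lemma post_var_eq_residual: "post_var K xs n x = signed_sum (residual K xs n x) (K x)"
  by (simp add: post_var_def signed_sum_residual)

text \<open>Interpolation is exact on sections at data points, because the inverse Gram matrix is a
  left inverse.\<close>

lemma residual_orthogonal:
  fixes xs :: "nat \<Rightarrow> 'a::euclidean_space"
  assumes l: "l \<noteq> 0" and inj: "inj_on xs {1..n}" and m: "m \<in> {1..n}"
  shows "signed_sum (residual (se_kernel l) xs n x) (se_kernel l (xs m)) = 0"
proof -
  let ?M = "mat_inv_n n (gram (se_kernel l) xs)"
  have sym: "se_kernel l y z = se_kernel l z y" for y z :: 'a
    using psd_se_kernel[OF l] unfolding psd_kernel_def by blast
  have inv: "(\<Sum>j\<in>{1..n}. ?M i j * gram (se_kernel l) xs j m) = (if i = m then 1 else 0)"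
    if "i \<in> {1..n}" for i
    by (rule mat_inv_n_left[OF _ gram_se_kernel_definite[OF l inj] that m]) (auto simp: gram_def sym)
  have "(\<Sum>i\<in>{1..n}. \<Sum>j\<in>{1..n}. se_kernel l x (xs i) * ?M i j * se_kernel l (xs m) (xs j))
      = (\<Sum>i\<in>{1..n}. se_kernel l x (xs i) * (\<Sum>j\<in>{1..n}. ?M i j * gram (se_kernel l) xs j m))"
    by (simp add: sum_distrib_left gram_def sym[of "xs m"] mult.assoc)
  also have "\<dots> = (\<Sum>i\<in>{1..n}. if i = m then se_kernel l x (xs m) else 0)"
    by (intro sum.cong refl) (simp only: inv, simp)
  also have "\<dots> = se_kernel l x (xs m)"
    using m by simp
  finally show ?thesis
    by (simp add: signed_sum_residual sym[of x])
qed

text \<open>The residual function vanishes at the data points, so only its value at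
  \<open>x\<close>, of weight 1, contributes.\<close>

lemma energy_residual:
  fixes xs :: "nat \<Rightarrow> 'a::euclidean_space"
  assumes l: "l \<noteq> 0" and inj: "inj_on xs {1..n}"
  shows "energy (se_kernel l) (residual (se_kernel l) xs n x) = post_var (se_kernel l) xs n x"
proof -
  have "energy (se_kernel l) (residual (se_kernel l) xs n x)
      = signed_sum (residual (se_kernel l) xs n x) (se_kernel l x)"
    unfolding pairing_def
    by (subst signed_sum_residual) (simp add: residual_orthogonal[OF l inj])
  then show ?thesis by (simp add: post_var_eq_residual)
qed

text \<open>Since \<open>g\<close> matches the data, the error is the residual measure applied to
  \<open>g\<close>, and the energy of that measure is the posterior variance.\<close>

lemma rkhs_ball_post_mean_error:
  fixes xs :: "nat \<Rightarrow> 'a::euclidean_space"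
  assumes l: "l \<noteq> 0" and inj: "inj_on xs {1..n}" and xs: "xs ` {1..n} \<subseteq> S" and x: "x \<in> S"
    and g: "g \<in> rkhs_ball (se_kernel l) S B" and eq: "\<And>i. i \<in> {1..n} \<Longrightarrow> g (xs i) = f i (xs i)"
  shows "\<bar>g x - post_mean (se_kernel l) xs f n x\<bar> \<le> B * post_sd (se_kernel l) xs n x"
proof -
  have "g x - post_mean (se_kernel l) xs f n x = signed_sum (residual (se_kernel l) xs n x) g"
    by (simp add: signed_sum_residual post_mean_def eq)
  then show ?thesis
    using signed_sum_rkhs_ball_le[OF psd_se_kernel[OF l] g, of "residual (se_kernel l) xs n x"] x xs
    by (simp add: snd_set_residual energy_residual[OF l inj] post_sd_def)
qed

lemma inner_self_unit_cube_le:
  fixes s :: "real ^ 'd"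
  assumes "s \<in> unit_cube" shows "s \<bullet> s \<le> real CARD('d)"
proof -
  have "s \<bullet> s = (\<Sum>i\<in>UNIV. s $ i * s $ i)"
    by (simp add: inner_vec_def)
  also have "\<dots> \<le> (\<Sum>i\<in>(UNIV :: 'd set). 1)"
  proof (rule sum_mono)
    fix i
    show "s $ i * s $ i \<le> 1"
      using assms unfolding unit_cube_def by (intro mult_le_one) auto
  qed
  finally show ?thesis by simp
qed

lemma post_sd_le_exp_tail:
  fixes xs :: "nat \<Rightarrow> real ^ 'd"
  assumes l: "l \<noteq> 0" and inj: "inj_on xs {1..n}" and xs: "xs ` {1..n} \<subseteq> unit_cube"
    and fill: "\<And>x. x \<in> unit_cube \<Longrightarrow> \<exists>p\<in>xs ` {1..n}. dist x p \<le> h"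
    and h: "64 * real N ^ 2 * real CARD('d) * h \<le> 1" and x: "x \<in> unit_cube"
  shows "post_sd (se_kernel l) xs n x
    \<le> 3 * sqrt (exp (real CARD('d) / l\<^sup>2) * (real CARD('d) / l\<^sup>2) ^ N / fact N)"
proof -
  let ?L = "residual (se_kernel l) xs n x"
  let ?A = "real CARD('d) / l\<^sup>2"
  let ?t = "sqrt (exp ?A * ?A ^ N / fact N)"
  let ?K = "\<lambda>x y :: real ^ 'd. gauss l x * gauss l y * exp_tail N ((x \<bullet> y) / l\<^sup>2)"
  define \<sigma> where "\<sigma> = post_sd (se_kernel l) xs n x"
  \<comment> \<open>With \<open>gauss l s\<close> factored out, \<open>p\<close> is the polynomial
    head and \<open>r\<close> the tail of the residual function.\<close>
  define p where "p s = signed_sum ?L (\<lambda>z. gauss l z * (\<Sum>k<N. ((s \<bullet> z) / l\<^sup>2) ^ k / fact k))" for s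
  define r where "r s = signed_sum ?L (\<lambda>z. gauss l z * exp_tail N ((s \<bullet> z) / l\<^sup>2))" for s
  have E: "energy (se_kernel l) ?L = post_var (se_kernel l) xs n x"
    by (rule energy_residual[OF l inj])
  have E_nonneg: "post_var (se_kernel l) xs n x \<ge> 0"
    using psd_kernel_energy[OF psd_se_kernel[OF l]] E by metis
  have split: "signed_sum ?L (se_kernel l s) = gauss l s * (p s + r s)" for s
  proof -
    have "se_kernel l s = (\<lambda>z. gauss l s * (gauss l z * (\<Sum>k<N. ((s \<bullet> z) / l\<^sup>2) ^ k / fact k)
        + gauss l z * exp_tail N ((s \<bullet> z) / l\<^sup>2)))"
      by (intro ext) (simp add: se_kernel_eq[OF l] exp_tail_def algebra_simps)
    then show ?thesis
      by (simp only: p_def r_def signed_sum_cmult signed_sum_add)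
  qed
  have r_le: "\<bar>r s\<bar> \<le> ?t * \<sigma>" if s: "s \<in> unit_cube" for s
  proof -
    \<comment> \<open>Cauchy-Schwarz in the tail kernel; \<open>gauss l s\<close> appears on both
      sides and cancels.\<close>
    have "gauss l s * \<bar>r s\<bar> = \<bar>signed_sum ?L (?K s)\<bar>"
      using gauss_pos[of l s] by (simp add: r_def mult.assoc signed_sum_cmult abs_mult)
    also have "\<dots> \<le> sqrt (?K s s) * sqrt (energy ?K ?L)"
      by (rule signed_sum_kernel_le[OF psd_kernel_exp_tail])
    also have "\<dots> \<le> sqrt (?K s s) * \<sigma>"
    proof (rule mult_left_mono)
      show "sqrt (energy ?K ?L) \<le> \<sigma>"
        using energy_exp_tail_le[OF l, of N ?L] E by (simp add: \<sigma>_def post_sd_def)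
      show "0 \<le> sqrt (?K s s)"
        using psd_kernel_energy[OF psd_kernel_exp_tail[of l N], of "[(1, s)]"]
        by (simp add: pairing_def)
    qed
    also have "sqrt (?K s s) = gauss l s * sqrt (exp_tail N ((s \<bullet> s) / l\<^sup>2))"
      using gauss_pos[of l s] by (simp add: real_sqrt_mult)
    finally have "\<bar>r s\<bar> \<le> sqrt (exp_tail N ((s \<bullet> s) / l\<^sup>2)) * \<sigma>"
      using gauss_pos[of l s] by (simp add: mult.assoc)
    also have "\<dots> \<le> ?t * \<sigma>"
    proof (rule mult_right_mono)
      show "sqrt (exp_tail N ((s \<bullet> s) / l\<^sup>2)) \<le> ?t"
        using inner_self_unit_cube_le[OF s] l
        by (intro real_sqrt_le_mono exp_tail_le divide_right_mono) auto
    qed (simp add: \<sigma>_def post_sd_def E_nonneg)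
    finally show ?thesis .
  qed
  have "\<bar>p x\<bar> \<le> 2 * (?t * \<sigma>)"
  proof (rule coordwise_poly_norming[OF _ _ fill xs h _ x])
    have "coordwise_poly N (\<lambda>s. (gauss l z / (fact k * (l\<^sup>2) ^ k)) * (s \<bullet> z) ^ k)"
      if "k < N" for k and z :: "real ^ 'd"
      using that by (intro coordwise_poly_cmult coordwise_poly_inner_power) simp
    then have "coordwise_poly N (\<lambda>s. gauss l z * (((s \<bullet> z) / l\<^sup>2) ^ k / fact k))"
      if "k < N" for k and z :: "real ^ 'd"
      using that by (simp add: power_divide mult.commute)
    then show "coordwise_poly N p"
      unfolding p_def sum_distrib_left
      by (intro coordwise_poly_signed_sum coordwise_poly_sum) auto
    show "continuous_on unit_cube p"
      unfolding p_def using l by (intro continuous_on_signed_sum continuous_intros) auto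
    fix q assume q: "q \<in> xs ` {1..n}"
    then obtain m where m: "m \<in> {1..n}" "q = xs m" by blast
    have "gauss l q * (p q + r q) = 0"
      using residual_orthogonal[OF l inj m(1), of x] split[of q] m(2) by simp
    then have "p q = - r q"
      using gauss_pos[of l q] by simp
    moreover have "q \<in> unit_cube" using q xs by blast
    ultimately show "\<bar>p q\<bar> \<le> ?t * \<sigma>" using r_le by simp
  qed auto
  then have pr: "p x + r x \<le> 3 * (?t * \<sigma>)"
    using r_le[OF x] by linarith
  have "\<sigma>\<^sup>2 = gauss l x * (p x + r x)"
    using E_nonneg split[of x] by (simp add: \<sigma>_def post_sd_def post_var_eq_residual)
  also have "\<dots> \<le> gauss l x * (3 * (?t * \<sigma>))"
    using pr gauss_pos[of l x] by (intro mult_left_mono) auto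
  also have "\<dots> \<le> 1 * (3 * (?t * \<sigma>))"
    using E_nonneg by (intro mult_right_mono) (auto simp: gauss_def \<sigma>_def post_sd_def)
  finally have "\<sigma> * \<sigma> \<le> (3 * ?t) * \<sigma>" by (simp add: power2_eq_square)
  moreover have "\<sigma> \<ge> 0" using E_nonneg by (simp add: \<sigma>_def post_sd_def)
  moreover have "3 * ?t \<ge> 0" by simp
  \<comment> \<open>One factor \<open>\<sigma>\<close> cancels; if it is zero the bound is
    trivial.\<close>
  ultimately have "\<sigma> \<le> 3 * ?t"
    by (cases "\<sigma> = 0") (auto simp: mult_le_cancel_right)
  then show ?thesis by (simp add: \<sigma>_def)
qed

section \<open>The fill distance of a finite set\<close>

lemma fill_distance_attained:
  fixes P :: "'a::metric_space set"
  assumes P: "finite P" "P \<noteq> {}" and S: "bounded S" and x: "x \<in> S"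
  obtains p where "p \<in> P" "dist x p \<le> fill_distance S P"
proof -
  obtain q where q: "q \<in> P" using P by blast
  obtain e where e: "\<And>y. y \<in> S \<Longrightarrow> dist q y \<le> e"
    using S bounded_any_center[of S q] by blast
  \<comment> \<open>A real supremum bounds its members only for a family bounded above; the distance
    to one point \<open>q\<close> supplies the bound.\<close>
  have "bdd_above ((\<lambda>x. INF p\<in>P. dist x p) ` S)"
  proof (rule bdd_aboveI2)
    fix y assume "y \<in> S"
    have "(INF p\<in>P. dist y p) \<le> dist y q"
      using P q by (intro cINF_lower) auto
    then show "(INF p\<in>P. dist y p) \<le> e"
      using e[OF \<open>y \<in> S\<close>] by (simp add: dist_commute)
  qed
  then have le: "(INF p\<in>P. dist x p) \<le> fill_distance S P"
    unfolding fill_distance_def using x by (intro cSUP_upper) auto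
  have "(INF p\<in>P. dist x p) \<in> dist x ` P"
    using P by (simp add: cInf_eq_Min)
  then show thesis using that le by force
qed

lemma infinite_unit_cube: "infinite (unit_cube :: (real ^ 'd) set)"
proof
  assume fin: "finite (unit_cube :: (real ^ 'd) set)"
  have "(\<lambda>t. (\<chi> i. t) :: real ^ 'd) ` {0..1} \<subseteq> unit_cube"
    by (auto simp: unit_cube_def)
  moreover have "inj_on (\<lambda>t. (\<chi> i. t) :: real ^ 'd) {0..1}"
    by (auto simp: inj_on_def vec_eq_iff)
  ultimately have "finite {0..1::real}"
    using fin finite_subset finite_imageD by metis
  then show False
    using infinite_Icc[of 0 "1::real"] by simp
qed

text \<open>A finite set misses some point of the infinite cube. Positivity is what makes the
  logarithm of the fill distance meaningful.\<close>

lemma fill_distance_unit_cube_pos: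
  fixes P :: "(real ^ 'd) set"
  assumes "finite P" "P \<noteq> {}"
  shows "fill_distance unit_cube P > 0"
proof -
  obtain x :: "real ^ 'd" where x: "x \<in> unit_cube" "x \<notin> P"
    using assms infinite_unit_cube finite_subset by (metis subsetI)
  obtain p where "p \<in> P" "dist x p \<le> fill_distance unit_cube P"
    using fill_distance_attained[OF assms compact_imp_bounded[OF compact_unit_cube] x(1)] by metis
  then show ?thesis
    using x(2) by (metis zero_less_dist_iff less_le_trans)
qed

text \<open>The constants precede \<open>B\<close>, \<open>T\<close>, the points and the functions,
  so they depend only on \<open>l\<close> and the dimension. Distinctness of the points makes the
  Gram matrix invertible.\<close>

theorem theorem8:
  fixes l :: real
  assumes "l > 0"
  shows "\<exists>c>0. \<exists>h0>0. \<forall>B T (xs :: nat \<Rightarrow> real ^ 'd) (f :: nat \<Rightarrow> real ^ 'd \<Rightarrow> real).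
     B > 0 \<and> T \<ge> 2 \<and>
     (\<forall>i\<in>{1..<T}. xs i \<in> unit_cube) \<and> inj_on xs {1..<T} \<and>
     (\<forall>i\<in>{1..<T}. f i \<in> rkhs_ball (se_kernel l) unit_cube B) \<and>
     ucb_choice (se_kernel l) unit_cube B xs f T \<and>
     fill_distance unit_cube (xs ` {1..<T}) < h0
     \<longrightarrow> simple_adv_regret (se_kernel l) unit_cube B xs f T
         \<le> ereal (B * exp (c * ln (fill_distance unit_cube (xs ` {1..<T}))
                       / (2 * sqrt (fill_distance unit_cube (xs ` {1..<T})))))"
proof -
  define A where "A = real CARD('d) / l\<^sup>2"
  \<comment> \<open>\<open>b\<^sup>2 = 64 * CARD('d)\<close> turns the first rate condition into the
    mesh condition of the norming lemma.\<close>
  define b where "b = 8 * sqrt (real CARD('d))"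
  have "A > 0" "b > 0"
    using assms by (auto simp: A_def b_def)
  then obtain c h0 where c: "c > 0" "h0 > 0" and rate: "\<And>h. 0 < h \<Longrightarrow> h < h0 \<Longrightarrow>
      \<exists>N::nat. (b * real N)\<^sup>2 * h \<le> 1 \<and>
       6 * sqrt (exp A * A ^ N / fact N) \<le> exp (c * ln h / (2 * sqrt h))"
    using exp_tail_rate[of A b] by blast
  have "simple_adv_regret (se_kernel l) unit_cube B xs f T \<le> ereal (B * exp (c * ln h / (2 * sqrt h)))"
    if B: "B > 0" and T: "T \<ge> 2" and xs: "\<forall>i\<in>{1..<T}. xs i \<in> unit_cube" and inj: "inj_on xs {1..<T}"
      and ucb: "ucb_choice (se_kernel l) unit_cube B xs f T"
      and h_def: "h = fill_distance unit_cube (xs ` {1..<T})" and "h < h0"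
    for B T h and xs :: "nat \<Rightarrow> real ^ 'd" and f :: "nat \<Rightarrow> real ^ 'd \<Rightarrow> real"
  proof -
    let ?m = "post_mean (se_kernel l) xs f (T - 1)" and ?s = "post_sd (se_kernel l) xs (T - 1)"
    have I: "{1..<T} = {1..T - 1}" using T by auto
    have inj': "inj_on xs {1..T - 1}" and xs': "xs ` {1..T - 1} \<subseteq> unit_cube"
      using inj xs unfolding I by auto
    have P: "finite (xs ` {1..<T})" "xs ` {1..<T} \<noteq> {}" using T by auto
    have "h > 0"
      unfolding h_def by (rule fill_distance_unit_cube_pos[OF P])
    then obtain N where N: "(b * real N)\<^sup>2 * h \<le> 1"
        "6 * sqrt (exp A * A ^ N / fact N) \<le> exp (c * ln h / (2 * sqrt h))"
      using rate \<open>h < h0\<close> by blast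
    have l: "l \<noteq> 0" using assms by simp
    have xT: "xs T \<in> unit_cube"
      using ucb by (simp add: ucb_choice_def)
    have "?s (xs T) \<le> 3 * sqrt (exp A * A ^ N / fact N)"
      unfolding A_def
    proof (rule post_sd_le_exp_tail[OF l inj' xs' _ _ xT, where h = h])
      show "\<exists>p\<in>xs ` {1..T - 1}. dist x p \<le> h" if "x \<in> unit_cube" for x
        using fill_distance_attained[OF P compact_imp_bounded[OF compact_unit_cube] that]
        unfolding h_def I by metis
      show "64 * real N ^ 2 * real CARD('d) * h \<le> 1"
        using N(1) by (simp add: b_def power_mult_distrib mult_ac)
    qed
    then have s: "2 * ?s (xs T) \<le> exp (c * ln h / (2 * sqrt h))"
      using N(2) by linarith
    have round: "Sup (g ` unit_cube) - g (xs T) \<le> B * exp (c * ln h / (2 * sqrt h))"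
      if g: "g \<in> rkhs_ball (se_kernel l) unit_cube B" "\<forall>i\<in>{1..<T}. g (xs i) = f i (xs i)" for g
    proof -
      have err: "\<bar>g x - ?m x\<bar> \<le> B * ?s x" if "x \<in> unit_cube" for x
        by (rule rkhs_ball_post_mean_error[OF l inj' xs' that g(1)]) (use g(2)[unfolded I] in blast)
      \<comment> \<open>The error bound at \<open>x\<close>, the UCB choice and the error bound at
        \<open>xs T\<close> are chained.\<close>
      have "g x \<le> g (xs T) + B * (2 * ?s (xs T))" if "x \<in> unit_cube" for x
      proof -
        have "?m x + B * ?s x \<le> ?m (xs T) + B * ?s (xs T)"
          using ucb that by (simp add: ucb_choice_def)
        then show ?thesis using err[OF that] err[OF xT] by linarith
      qed
      then have "Sup (g ` unit_cube) \<le> g (xs T) + B * (2 * ?s (xs T))"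
        using zero_in_unit_cube by (intro cSup_least) auto
      moreover have "B * (2 * ?s (xs T)) \<le> B * exp (c * ln h / (2 * sqrt h))"
        using B s by (intro mult_left_mono) auto
      ultimately show ?thesis by linarith
    qed
    \<comment> \<open>The minimum over rounds is at most its last entry.\<close>
    have "simple_adv_regret (se_kernel l) unit_cube B xs f T
        \<le> adv_regret_round (se_kernel l) unit_cube B xs f T"
      unfolding simple_adv_regret_def using T by (intro Min_le) auto
    also have "\<dots> \<le> ereal (B * exp (c * ln h / (2 * sqrt h)))"
      unfolding adv_regret_round_def by (intro SUP_least) (use round in auto)
    finally show ?thesis .
  qed
  then show ?thesis
    using c by (intro exI[of _ c] conjI exI[of _ h0] allI impI) auto
qed

end
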